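(* Let $\Pi$ be a protocol and suppose that $G=\forall\vec x\,.\,(\phi\supset\exists\vec y\,.\,\psi)$ is a security goal in $\mathcal L(\Pi)$ where $\phi$ is satisfiable. Let $\mathsf{cs}(\phi)$ be the characteristic skeleton of $\phi$. Then $\Pi$ achieves $G$ if and only if, whenever $H:\mathsf{cs}(\phi)\mapsto\mathbb B$ is a shape, there is an assignment $\sigma$ such that $\mathbb B,\sigma\models\psi$.
   Context: MESSAGES. $\mathfrak A_0$ (the atoms) is the disjoint union of infinite sets of nonces, atomic keys (symmetric or asymmetric), names and texts, with operators: $\mathsf{sk}(a)$ (signature key of name $a$), $\mathsf{pk}(a)$ (public encryption key of name $a$), both atomic keys, and $K\mapsto K^{-1}$, mapping an asymmetric atomic key to its inverse and a symmetric one to itself. Homomorphisms $\eta$ of $\mathfrak A_0$ respect sorts and commute with these operators. $X$ is an infinite set, disjoint from $\mathfrak A_0$, of (untyped) indeterminates. The algebra $\mathfrak A$ of messages is freely generated from $\mathfrak A_0\cup X$ by encryption $\{|t_0|\}_{t_1}$ (a non-atomic key $t_1$ is symmetric) and tagged concatenation $\mathit{tag}\;t_0\,\hat{\ }\,t_1$ (tags from a fixed set). A homomorphism $\alpha=(\eta,\chi)$ of $\mathfrak A$ consists of a homomorphism $\eta$ on atoms and a function $\chi:X\to\mathfrak A$, extended to all messages by commuting with encryption and tagged concatenation. Atoms and indeterminates are jointly called parameters. The ingredient relation $\sqsubseteq$ is the least reflexive transitive relation with $t_1\sqsubseteq t_1\hat{\ }t_2$, $t_2\sqsubseteq t_1\hat{\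 }t_2$ (for any tag) and $t_1\sqsubseteq\{|t_1|\}_{t_2}$. STRANDS AND PROTOCOLS. A strand is a finite sequence of nodes $n_1\Rightarrow\dots\Rightarrow n_j$, each transmitting or receiving a message $\mathsf{msg}(n_i)$; $s\downarrow i$ is the $i$-th node of $s$ (1-based). $\Rightarrow^+$, $\Rightarrow^*$ are the transitive and reflexive-transitive closures of $\Rightarrow$. A message $t$ originates at $n$ if $n$ is a transmission node, $t\sqsubseteq\mathsf{msg}(n)$, and $t\not\sqsubseteq\mathsf{msg}(m)$ whenever $m\Rightarrow^+n$. A protocol $\Pi$ is a finite set of strands, its roles: $\rho_1,\dots,\rho_r$, with $\rho_i$ of length $|\rho_i|$, together with a listener role consisting of one node that receives a value. A node $m_j$ is an instance of the $j$-th node $n_j$ of a role $n_1\Rightarrow\dots\Rightarrow n_j\Rightarrow\dots$ if for some homomorphism $\alpha$ the strand of $m_j$, up to $m_j$, is $\alpha(n_1)\Rightarrow\dots\Rightarrow\alpha(n_j)=m_j$ (messages and directions agree; the remainders of the strands are unconstrained). $\mathsf{nodes}(\Pi)$ denotes the nodes of instances of roles of $\Pi$. SKELETONS. A skeleton $\mathbb A$ consists of a finite set $\mathsf{nodes}(\mathbb A)$ of nodes of (possibly partially executed) role instances, a partial order $\preceq_{\mathbb A}$ on it, and sets $\mathsf{unique}_{\mathbb A},\mathsf{non}_{\mathbb A}$ of atoms, such that: if $n_1\in\mathsf{nodes}(\mathbb A)$ and $n_0\Rightarrow n_1$ then $n_0\in\mathsf{nodes}(\mathbb A)$ and $n_0\preceq_{\mathbb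 A}n_1$; each $a\in\mathsf{unique}_{\mathbb A}$ originates at most once in $\mathsf{nodes}(\mathbb A)$; each $a\in\mathsf{non}_{\mathbb A}$ originates nowhere in $\mathsf{nodes}(\mathbb A)$. $\mathbb A$ is a skeleton for $\Pi$ if all its strands are strands of $\Pi$; all skeletons below are skeletons for $\Pi$. $\mathbb A$ is realized if for every reception node $n$ of $\mathbb A$, the adversary can construct $\mathsf{msg}(n)$ via Dolev-Yao actions (concatenating messages, separating the pieces of a concatenation, encrypting a given plaintext with a given key, decrypting a given ciphertext with the matching decryption key) from the inputs: messages $\mathsf{msg}(m)$ with $m\prec_{\mathbb A}n$ a transmission node; indeterminates; and atoms $a$ such that $a\notin\mathsf{non}_{\mathbb A}\cup\mathsf{unique}_{\mathbb A}$, or such that $a\in\mathsf{unique}_{\mathbb A}$ but $a$ originates nowhere in $\mathbb A$. HOMOMORPHISMS. For skeletons $\mathbb A_0,\mathbb A_1$, a homomorphism $\alpha$ of $\mathfrak A$ and $\zeta:\mathsf{nodes}(\mathbb A_0)\to\mathsf{nodes}(\mathbb A_1)$, $H=[\zeta,\alpha]$ is a homomorphism $\mathbb A_0\mapsto\mathbb A_1$ if: (1a) $\mathsf{msg}(\zeta(n))=\alpha(\mathsf{msg}(n))$ with the same direction, for all $n$; (1b) if $s\downarrow i\in\mathbb A_0$ there is $s'$ with $\zeta(s\downarrow j)=s'\downarrow j$ for all $j\le i$; (2) $n\preceq_{\mathbb A_0}m$ implies $\zeta(n)\preceq_{\mathbb A_1}\zeta(m)$; (3) $\alpha(\mathsf{non}_{\mathbb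 A_0})\subseteq\mathsf{non}_{\mathbb A_1}$; (4a) $\alpha(\mathsf{unique}_{\mathbb A_0})\subseteq\mathsf{unique}_{\mathbb A_1}$; (4b) if $a\in\mathsf{unique}_{\mathbb A_0}$ originates at $n\in\mathsf{nodes}(\mathbb A_0)$ then $\alpha(a)$ originates at $\zeta(n)$. $[\zeta,\alpha]=[\zeta,\alpha']$ when $\alpha(a)=\alpha'(a)$ for every $a$ that is an ingredient or is used for encryption in the domain of $\zeta$. Write $H(n)=\zeta(n)$, $H(a)=\alpha(a)$. SHAPES. The shapes for $\mathbb A$ are the minimal, essentially different homomorphisms from $\mathbb A$ to realized skeletons. Precisely: call $[\zeta,\alpha]$ nodewise injective if $\zeta$ is injective; for homomorphisms $H_0,H_1$ with source $\mathbb A$ write $H_0\le_n H_1$ if $H_1=J\circ H_0$ for some nodewise injective homomorphism $J$. A homomorphism $H:\mathbb A\mapsto\mathbb B$ with $\mathbb B$ realized is a shape if, for every homomorphism $H_1$ from $\mathbb A$ to a realized skeleton, $H_1\le_n H$ implies $H\le_n H_1$. (Known fact: every homomorphism $J$ from $\mathbb A$ to a realized skeleton factors as $J=K\circ H$ with $H$ a shape.) LANGUAGE $\mathcal L(\Pi)$. Classical first-order language with unsorted variables ranging over messages and nodes; unary function symbols $\mathtt{sk},\mathtt{pk},\mathtt{inv}$ (terms built with these are key terms); predicates $=$, $\mathtt{false}$, $\mathtt{Non}(v)$, $\mathtt{Unq}(v)$, $\mathtt{Col}(m,n)$, $\mathtt{Preceq}(m,n)$, and role predicates $\mathtt{RP}_{ij}(m,v_1,\dots,v_k)$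 for each role $\rho_i$ and $1\le j\le|\rho_i|$, with one argument $m$ for the node and one for each of the $k$ parameters appearing in the first $j$ messages of $\rho_i$. The role predicate of the listener role is written $\mathtt{Lsn}(m,v)$. A security claim is a conjunction of atomic formulas such that (a) any two role predicate conjuncts have different variables as first arguments; (b) if a conjunct is not a role predicate, each variable or key term appearing as an argument to it also appears as an argument to some role predicate conjunct. A security goal is a sentence $\forall\vec x\,.\,(\phi\supset\exists\vec y\,.\,\psi)$ where $\vec x,\vec y$ are disjoint, $\phi$ is a security claim, and $\psi=\bigvee_i\phi_i$ is a disjunction (possibly empty, i.e. $\mathtt{false}$) of conjunctions $\phi_i$ of atomic formulas. SATISFACTION. An assignment is a partial function $\sigma$ from variables to $\mathfrak A\cup\mathsf{nodes}(\Pi)$, extended to key terms by $\sigma(\mathtt{sk}(t))=\mathsf{sk}(\sigma(t))$, $\sigma(\mathtt{pk}(t))=\mathsf{pk}(\sigma(t))$, $\sigma(\mathtt{inv}(t))=\sigma(t)^{-1}$. If $\sigma$ is undefined on a free variable of $\Phi$ then $\mathbb A,\sigma\not\models\Phi$. $\mathbb A,\sigma\models\Phi$ is defined by the Tarski clauses and: $u=v$ iff $\sigma(u)=\sigma(v)$; $\mathtt{Non}(v)$ iff $\sigma(v)\in\mathsf{non}_{\mathbb A}$; $\mathtt{Unq}(v)$ iff $\sigma(v)\in\mathsf{unique}_{\mathbb A}$; $\mathtt{Col}(m,n)$ iff $\sigma(m),\sigma(n)\in\mathsf{nodes}(\mathbb A)$ and $\sigma(m)\Rightarrow^*\sigma(n)$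 or $\sigma(n)\Rightarrow^*\sigma(m)$; $\mathtt{Preceq}(m,n)$ iff $\sigma(m)\preceq_{\mathbb A}\sigma(n)$; $\mathtt{RP}_{ij}(m,v_1,\dots,v_k)$ iff $\sigma(m)\in\mathsf{nodes}(\mathbb A)$ is an instance of the $j$-th node of $\rho_i$ with parameters $\sigma(v_1),\dots,\sigma(v_k)$. $\phi$ is satisfiable if $\mathbb A,\sigma\models\phi$ for some $\mathbb A,\sigma$. For a sentence $G$, a skeleton satisfies $G$ if it does so under all assignments. ACHIEVING A GOAL. $\Pi$ achieves $G$ iff every realized skeleton for $\Pi$ satisfies $G$. A counterexample to $G$ is a realized skeleton $\mathbb C$ for $\Pi$ such that, for some assignment $\sigma$, $\mathbb C,\sigma\models\phi$, and for every extension $\sigma'$ of $\sigma$, $\mathbb C,\sigma'\models\lnot\psi$. CHARACTERISTIC SKELETON. A pair $\mathbb A,\sigma_*$ is characteristic for $\phi$ iff $\mathbb A,\sigma_*\models\phi$ and for all $\mathbb B,\sigma$: $\mathbb B,\sigma\models\phi$ implies there is a unique homomorphism $H:\mathbb A\mapsto\mathbb B$ such that $\sigma$ restricted to the free variables of $\phi$ equals $H\circ\sigma_*$. Then $\mathbb A$ is called a characteristic skeleton for $\phi$. Every satisfiable security claim $\phi$ has such a pair, unique up to isomorphism, and $\mathsf{cs}(\phi)$ denotes its skeleton.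
   Formalization: The assignment σ with B,σ ⊨ ψ is required to extend H∘σ_* (and any choice of values for variables of x not free in φ), where σ_* belongs to the characteristic pair; with an unconstrained σ, as written, the "if" direction is false. *)

theory Defs
  imports Main
begin

section \<open>Messages\<close>

text \<open>
  Atoms are built freely.  \<open>AsymK b True\<close> and \<open>AsymK b False\<close> are the two mutually inverse
  halves of the key pair \<open>b\<close>.  Besides the signature and encryption pairs belonging to names
  there are infinitely many anonymous pairs, which a homomorphism may send to any pair.
\<close>

datatype keypair = AnonPair nat | SigPair nat | EncPair nat

datatype atom =
    Nonce nat
  | Text nat
  | Name nat
  | SymK nat
  | AsymK keypair bool

datatype sort = NonceSort | TextSort | NameSort | SymSort | AsymSort

fun sort_of :: "atom \<Rightarrow> sort" where
  "sort_of (Nonce _) = NonceSort"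
| "sort_of (Text _) = TextSort"
| "sort_of (Name _) = NameSort"
| "sort_of (SymK _) = SymSort"
| "sort_of (AsymK _ _) = AsymSort"

text \<open>
  The operators on atoms are partial: \<open>sk\<close> and \<open>pk\<close> apply only to names, and key inversion
  only to atomic keys.  In particular an indeterminate has no inverse, since it may be
  instantiated by an asymmetric key as well as by any other message.
\<close>

fun sk_atom :: "atom \<Rightarrow> atom option" where
  "sk_atom (Name a) = Some (AsymK (SigPair a) True)"
| "sk_atom _ = None"

fun pk_atom :: "atom \<Rightarrow> atom option" where
  "pk_atom (Name a) = Some (AsymK (EncPair a) True)"
| "pk_atom _ = None"

fun inv_atom :: "atom \<Rightarrow> atom option" where
  "inv_atom (SymK k) = Some (SymK k)"
| "inv_atom (AsymK b h) = Some (AsymK b (\<not> h))"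
| "inv_atom _ = None"

definition atom_hom :: "(atom \<Rightarrow> atom) \<Rightarrow> bool" where
  "atom_hom \<eta> \<longleftrightarrow>
     (\<forall>a. sort_of (\<eta> a) = sort_of a) \<and>
     (\<forall>a. sk_atom (\<eta> a) = map_option \<eta> (sk_atom a)) \<and>
     (\<forall>a. pk_atom (\<eta> a) = map_option \<eta> (pk_atom a)) \<and>
     (\<forall>a. inv_atom (\<eta> a) = map_option \<eta> (inv_atom a))"

text \<open>The type variable \<open>'t\<close> is the set of tags.\<close>

datatype 't msg =
    Atm atom
  | Ind nat
  | Enc "'t msg" "'t msg"  \<comment> \<open>\<open>Enc t k\<close>: plaintext \<open>t\<close>, key \<open>k\<close>\<close>
  | Cat 't "'t msg" "'t msg"

type_synonym 't mhom = "(atom \<Rightarrow> atom) \<times> (nat \<Rightarrow> 't msg)"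

definition mhom :: "'t mhom \<Rightarrow> bool" where
  "mhom \<alpha> \<longleftrightarrow> atom_hom (fst \<alpha>)"

primrec app :: "'t mhom \<Rightarrow> 't msg \<Rightarrow> 't msg" where
  "app \<alpha> (Atm a) = Atm (fst \<alpha> a)"
| "app \<alpha> (Ind x) = snd \<alpha> x"
| "app \<alpha> (Enc t k) = Enc (app \<alpha> t) (app \<alpha> k)"
| "app \<alpha> (Cat g t u) = Cat g (app \<alpha> t) (app \<alpha> u)"

definition mhom_comp :: "'t mhom \<Rightarrow> 't mhom \<Rightarrow> 't mhom" where
  "mhom_comp \<beta> \<alpha> = (fst \<beta> \<circ> fst \<alpha>, app \<beta> \<circ> snd \<alpha>)"

inductive ingredient :: "'t msg \<Rightarrow> 't msg \<Rightarrow> bool"  (infix "\<sqsubseteq>" 50) where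
  ingredient_refl: "t \<sqsubseteq> t"
| ingredient_trans: "t \<sqsubseteq> u \<Longrightarrow> u \<sqsubseteq> v \<Longrightarrow> t \<sqsubseteq> v"
| ingredient_left: "t \<sqsubseteq> Cat g t u"
| ingredient_right: "u \<sqsubseteq> Cat g t u"
| ingredient_enc: "t \<sqsubseteq> Enc t k"

text \<open>The atoms and indeterminates occurring in a message, possibly inside encryption keys.\<close>

primrec msg_params :: "'t msg \<Rightarrow> 't msg list" where
  "msg_params (Atm a) = [Atm a]"
| "msg_params (Ind x) = [Ind x]"
| "msg_params (Enc t k) = msg_params t @ msg_params k"
| "msg_params (Cat g t u) = msg_params t @ msg_params u"


section \<open>Strands and protocols\<close>

datatype dir = Transmission | Reception

type_synonym 't trace = "(dir \<times> 't msg) list"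

text \<open>
  A strand carries an identity in addition to its trace, so that there are infinitely many
  different strands with the same trace.  The node \<open>(s, i)\<close> is the \<open>i\<close>-th node of \<open>s\<close>, counted
  from 1.
\<close>

type_synonym 't strand = "nat \<times> 't trace"
type_synonym 't node = "'t strand \<times> nat"

definition is_node :: "'t node \<Rightarrow> bool" where
  "is_node n \<longleftrightarrow> 1 \<le> snd n \<and> snd n \<le> length (snd (fst n))"

definition event :: "'t node \<Rightarrow> dir \<times> 't msg" where
  "event n = snd (fst n) ! (snd n - 1)"

definition node_dir :: "'t node \<Rightarrow> dir" where
  "node_dir n = fst (event n)"

definition node_msg :: "'t node \<Rightarrow> 't msg" where
  "node_msg n = snd (event n)"

definition succ :: "'t node \<Rightarrow> 't node \<Rightarrow> bool" where
  "succ m n \<longleftrightarrow> is_node m \<and> is_node n \<and> fst m = fst n \<and> snd n = Suc (snd m)"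

definition originates :: "'t msg \<Rightarrow> 't node \<Rightarrow> bool" where
  "originates t n \<longleftrightarrow>
     node_dir n = Transmission \<and> t \<sqsubseteq> node_msg n \<and>
     (\<forall>m. succ\<^sup>+\<^sup>+ m n \<longrightarrow> \<not> t \<sqsubseteq> node_msg m)"

text \<open>A protocol is given by its set of roles; the listener role is always present.\<close>

definition listener :: "'t trace" where
  "listener = [(Reception, Ind 0)]"

definition roles :: "'t trace set \<Rightarrow> 't trace set" where
  "roles \<Pi> = insert listener \<Pi>"

definition protocol :: "'t trace set \<Rightarrow> bool" where
  "protocol \<Pi> \<longleftrightarrow> finite \<Pi>"

definition app_trace :: "'t mhom \<Rightarrow> 't trace \<Rightarrow> 't trace" where
  "app_trace \<alpha> = map (\<lambda>(d, t). (d, app \<alpha> t))"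

definition instance_under :: "'t mhom \<Rightarrow> 't trace \<Rightarrow> nat \<Rightarrow> 't node \<Rightarrow> bool" where
  "instance_under \<alpha> \<rho> j n \<longleftrightarrow>
     mhom \<alpha> \<and> is_node n \<and> snd n = j \<and> j \<le> length \<rho> \<and>
     take j (snd (fst n)) = app_trace \<alpha> (take j \<rho>)"

definition nodes_of :: "'t trace set \<Rightarrow> 't node set" where
  "nodes_of \<Pi> = {n. \<exists>\<rho>\<in>roles \<Pi>. \<exists>j \<alpha>. instance_under \<alpha> \<rho> j n}"


section \<open>Skeletons\<close>

record 't skeleton =
  nodes :: "'t node set"
  leq :: "'t node rel"
  uniq :: "atom set"
  non :: "atom set"

definition skeleton :: "'t trace set \<Rightarrow> 't skeleton \<Rightarrow> bool" where
  "skeleton \<Pi> A \<longleftrightarrow>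
     finite (nodes A) \<and>
     nodes A \<subseteq> nodes_of \<Pi> \<and>
     partial_order_on (nodes A) (leq A) \<and>
     (\<forall>n1\<in>nodes A. \<forall>n0. succ n0 n1 \<longrightarrow> n0 \<in> nodes A \<and> (n0, n1) \<in> leq A) \<and>
     (\<forall>a\<in>uniq A. \<forall>m\<in>nodes A. \<forall>n\<in>nodes A.
        originates (Atm a) m \<and> originates (Atm a) n \<longrightarrow> m = n) \<and>
     (\<forall>a\<in>non A. \<forall>n\<in>nodes A. \<not> originates (Atm a) n)"

text \<open>
  The key that decrypts a message encrypted with \<open>k\<close>.  Every key other than an asymmetric
  atomic one is used symmetrically.
\<close>

fun decryption_key :: "'t msg \<Rightarrow> 't msg" where
  "decryption_key (Atm (AsymK b h)) = Atm (AsymK b (\<not> h))"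
| "decryption_key k = k"

inductive derivable :: "'t msg set \<Rightarrow> 't msg \<Rightarrow> bool" for S where
  derivable_input: "t \<in> S \<Longrightarrow> derivable S t"
| derivable_cat: "derivable S t \<Longrightarrow> derivable S u \<Longrightarrow> derivable S (Cat g t u)"
| derivable_left: "derivable S (Cat g t u) \<Longrightarrow> derivable S t"
| derivable_right: "derivable S (Cat g t u) \<Longrightarrow> derivable S u"
| derivable_enc: "derivable S t \<Longrightarrow> derivable S k \<Longrightarrow> derivable S (Enc t k)"
| derivable_dec: "derivable S (Enc t k) \<Longrightarrow> derivable S (decryption_key k) \<Longrightarrow> derivable S t"

definition adversary_inputs :: "'t skeleton \<Rightarrow> 't node \<Rightarrow> 't msg set" where
  "adversary_inputs A n =
     {node_msg m | m. m \<in> nodes A \<and> node_dir m = Transmission \<and> (m, n) \<in> leq A \<and> m \<noteq> n} \<union>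
     range Ind \<union>
     {Atm a | a. a \<notin> non A \<union> uniq A} \<union>
     {Atm a | a. a \<in> uniq A \<and> (\<forall>m\<in>nodes A. \<not> originates (Atm a) m)}"

definition realized :: "'t trace set \<Rightarrow> 't skeleton \<Rightarrow> bool" where
  "realized \<Pi> A \<longleftrightarrow> skeleton \<Pi> A \<and>
     (\<forall>n\<in>nodes A. node_dir n = Reception \<longrightarrow> derivable (adversary_inputs A n) (node_msg n))"


section \<open>Homomorphisms and shapes\<close>

text \<open>
  A homomorphism is represented by a pair \<open>(\<zeta>, \<alpha>)\<close>, where only the restriction of \<open>\<zeta>\<close> to the
  nodes of the source matters.  Two pairs represent the same homomorphism when they are
  related by \<open>hom_eq\<close>; statements about equality or uniqueness of homomorphisms use \<open>hom_eq\<close>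
  in place of equality of pairs.
\<close>

type_synonym 't hom = "('t node \<Rightarrow> 't node) \<times> 't mhom"

definition hom :: "'t skeleton \<Rightarrow> 't skeleton \<Rightarrow> 't hom \<Rightarrow> bool" where
  "hom A B H \<longleftrightarrow> (case H of (\<zeta>, \<alpha>) \<Rightarrow>
     mhom \<alpha> \<and>
     \<zeta> ` nodes A \<subseteq> nodes B \<and>
     (\<forall>n\<in>nodes A. node_msg (\<zeta> n) = app \<alpha> (node_msg n) \<and> node_dir (\<zeta> n) = node_dir n) \<and>
     (\<forall>s i. (s, i) \<in> nodes A \<longrightarrow> (\<exists>s'. \<forall>j. 1 \<le> j \<and> j \<le> i \<longrightarrow> \<zeta> (s, j) = (s', j))) \<and>
     (\<forall>n m. (n, m) \<in> leq A \<longrightarrow> (\<zeta> n, \<zeta> m) \<in> leq B) \<and>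
     fst \<alpha> ` non A \<subseteq> non B \<and>
     fst \<alpha> ` uniq A \<subseteq> uniq B \<and>
     (\<forall>a\<in>uniq A. \<forall>n\<in>nodes A.
        originates (Atm a) n \<longrightarrow> originates (Atm (fst \<alpha> a)) (\<zeta> n)))"

definition hom_eq :: "'t skeleton \<Rightarrow> 't hom \<Rightarrow> 't hom \<Rightarrow> bool" where
  "hom_eq A H H' \<longleftrightarrow>
     (\<forall>n\<in>nodes A. fst H n = fst H' n) \<and>
     (\<forall>n\<in>nodes A. \<forall>a. a \<sqsubseteq> node_msg n \<or> (\<exists>t. Enc t a \<sqsubseteq> node_msg n) \<longrightarrow>
        app (snd H) a = app (snd H') a)"

definition hom_comp :: "'t hom \<Rightarrow> 't hom \<Rightarrow> 't hom" where
  "hom_comp K H = (fst K \<circ> fst H, mhom_comp (snd K) (snd H))"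

definition nodewise_injective :: "'t skeleton \<Rightarrow> 't hom \<Rightarrow> bool" where
  "nodewise_injective A H \<longleftrightarrow> inj_on (fst H) (nodes A)"

text \<open>
  \<open>le_n A B0 H0 B1 H1\<close> is the relation \<open>H0 \<le>\<^sub>n H1\<close> between homomorphisms \<open>H0 : A \<mapsto> B0\<close> and
  \<open>H1 : A \<mapsto> B1\<close>.
\<close>

definition le_n ::
  "'t skeleton \<Rightarrow> 't skeleton \<Rightarrow> 't hom \<Rightarrow> 't skeleton \<Rightarrow> 't hom \<Rightarrow> bool" where
  "le_n A B0 H0 B1 H1 \<longleftrightarrow>
     (\<exists>J. hom B0 B1 J \<and> nodewise_injective B0 J \<and> hom_eq A H1 (hom_comp J H0))"

definition shape :: "'t trace set \<Rightarrow> 't skeleton \<Rightarrow> 't skeleton \<Rightarrow> 't hom \<Rightarrow> bool" where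
  "shape \<Pi> A B H \<longleftrightarrow>
     hom A B H \<and> realized \<Pi> B \<and>
     (\<forall>B1 H1. hom A B1 H1 \<and> realized \<Pi> B1 \<and> le_n A B1 H1 B H \<longrightarrow> le_n A B H B1 H1)"


section \<open>The goal language\<close>

type_synonym var = nat

datatype kterm = Var var | SkT kterm | PkT kterm | InvT kterm

text \<open>
  \<open>RP \<rho> j m ts\<close> is the role predicate for the \<open>j\<close>-th node of the role \<open>\<rho>\<close>; \<open>ts\<close> lists one
  argument for each parameter in \<open>role_params \<rho> j\<close>, in that order.
\<close>

datatype 't atomic =
    Eq kterm kterm
  | Falsum
  | Non kterm
  | Unq kterm
  | Col kterm kterm
  | Preceq kterm kterm
  | RP "'t trace" nat var "kterm list"

abbreviation Lsn :: "var \<Rightarrow> kterm \<Rightarrow> 't atomic" where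
  "Lsn m t \<equiv> RP listener 1 m [t]"

datatype 't form =
    Atomic "'t atomic"
  | Neg "'t form"
  | Conj "'t form list"
  | Disj "'t form list"
  | Imp "'t form" "'t form"
  | All var "'t form"
  | Ex var "'t form"

definition role_params :: "'t trace \<Rightarrow> nat \<Rightarrow> 't msg list" where
  "role_params \<rho> j = remdups (concat (map (msg_params \<circ> snd) (take j \<rho>)))"

fun is_RP :: "'t atomic \<Rightarrow> bool" where
  "is_RP (RP _ _ _ _) = True"
| "is_RP _ = False"

fun args :: "'t atomic \<Rightarrow> kterm set" where
  "args (Eq t u) = {t, u}"
| "args Falsum = {}"
| "args (Non t) = {t}"
| "args (Unq t) = {t}"
| "args (Col t u) = {t, u}"
| "args (Preceq t u) = {t, u}"
| "args (RP _ _ m ts) = insert (Var m) (set ts)"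

primrec kterm_var :: "kterm \<Rightarrow> var" where
  "kterm_var (Var v) = v"
| "kterm_var (SkT t) = kterm_var t"
| "kterm_var (PkT t) = kterm_var t"
| "kterm_var (InvT t) = kterm_var t"

fun fv :: "'t form \<Rightarrow> var set" where
  "fv (Atomic a) = kterm_var ` args a"
| "fv (Neg f) = fv f"
| "fv (Conj fs) = (\<Union>f\<in>set fs. fv f)"
| "fv (Disj fs) = (\<Union>f\<in>set fs. fv f)"
| "fv (Imp f g) = fv f \<union> fv g"
| "fv (All x f) = fv f - {x}"
| "fv (Ex x f) = fv f - {x}"

text \<open>Membership of an atomic formula in the language of \<open>\<Pi>\<close>.\<close>

fun atomic_of :: "'t trace set \<Rightarrow> 't atomic \<Rightarrow> bool" where
  "atomic_of \<Pi> (RP \<rho> j m ts) \<longleftrightarrow>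
     \<rho> \<in> roles \<Pi> \<and> 1 \<le> j \<and> j \<le> length \<rho> \<and> length ts = length (role_params \<rho> j)"
| "atomic_of \<Pi> _ \<longleftrightarrow> True"

definition security_claim :: "'t trace set \<Rightarrow> 't form \<Rightarrow> bool" where
  "security_claim \<Pi> \<phi> \<longleftrightarrow>
     (\<exists>as. \<phi> = Conj (map Atomic as) \<and>
        (\<forall>a\<in>set as. atomic_of \<Pi> a) \<and>
        distinct [m. RP \<rho> j m ts \<leftarrow> as] \<and>
        (\<forall>a\<in>set as. \<not> is_RP a \<longrightarrow> args a \<subseteq> \<Union> (args ` {b \<in> set as. is_RP b})))"

definition goal_form :: "var list \<Rightarrow> 't form \<Rightarrow> var list \<Rightarrow> 't form \<Rightarrow> 't form" where
  "goal_form xs \<phi> ys \<psi> = foldr All xs (Imp \<phi> (foldr Ex ys \<psi>))"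

definition security_goal ::
  "'t trace set \<Rightarrow> var list \<Rightarrow> 't form \<Rightarrow> var list \<Rightarrow> 't form \<Rightarrow> bool" where
  "security_goal \<Pi> xs \<phi> ys \<psi> \<longleftrightarrow>
     security_claim \<Pi> \<phi> \<and>
     (\<exists>ass. \<psi> = Disj (map (\<lambda>as. Conj (map Atomic as)) ass) \<and>
        (\<forall>as\<in>set ass. \<forall>a\<in>set as. atomic_of \<Pi> a)) \<and>
     set xs \<inter> set ys = {} \<and>
     fv (goal_form xs \<phi> ys \<psi>) = {}"


section \<open>Satisfaction\<close>

datatype 't val = MsgV "'t msg" | NodeV "'t node"

type_synonym 't asg = "var \<Rightarrow> 't val option"

definition vals :: "'t trace set \<Rightarrow> 't val set" where
  "vals \<Pi> = range MsgV \<union> NodeV ` nodes_of \<Pi>"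

definition assignment :: "'t trace set \<Rightarrow> 't asg \<Rightarrow> bool" where
  "assignment \<Pi> \<sigma> \<longleftrightarrow> ran \<sigma> \<subseteq> vals \<Pi>"

fun lift_op :: "(atom \<Rightarrow> atom option) \<Rightarrow> 't val option \<Rightarrow> 't val option" where
  "lift_op f (Some (MsgV (Atm a))) = map_option (MsgV \<circ> Atm) (f a)"
| "lift_op f _ = None"

primrec eval_kterm :: "'t asg \<Rightarrow> kterm \<Rightarrow> 't val option" where
  "eval_kterm \<sigma> (Var v) = \<sigma> v"
| "eval_kterm \<sigma> (SkT t) = lift_op sk_atom (eval_kterm \<sigma> t)"
| "eval_kterm \<sigma> (PkT t) = lift_op pk_atom (eval_kterm \<sigma> t)"
| "eval_kterm \<sigma> (InvT t) = lift_op inv_atom (eval_kterm \<sigma> t)"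

text \<open>
  An atomic formula is false when one of its arguments is undefined or has a value of the
  wrong kind.
\<close>

fun sat_atomic :: "'t skeleton \<Rightarrow> 't asg \<Rightarrow> 't atomic \<Rightarrow> bool" where
  "sat_atomic A \<sigma> (Eq t u) \<longleftrightarrow>
     eval_kterm \<sigma> t \<noteq> None \<and> eval_kterm \<sigma> t = eval_kterm \<sigma> u"
| "sat_atomic A \<sigma> Falsum \<longleftrightarrow> False"
| "sat_atomic A \<sigma> (Non t) \<longleftrightarrow> (\<exists>a\<in>non A. eval_kterm \<sigma> t = Some (MsgV (Atm a)))"
| "sat_atomic A \<sigma> (Unq t) \<longleftrightarrow> (\<exists>a\<in>uniq A. eval_kterm \<sigma> t = Some (MsgV (Atm a)))"
| "sat_atomic A \<sigma> (Col t u) \<longleftrightarrow>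
     (\<exists>m\<in>nodes A. \<exists>n\<in>nodes A.
        eval_kterm \<sigma> t = Some (NodeV m) \<and> eval_kterm \<sigma> u = Some (NodeV n) \<and>
        (succ\<^sup>*\<^sup>* m n \<or> succ\<^sup>*\<^sup>* n m))"
| "sat_atomic A \<sigma> (Preceq t u) \<longleftrightarrow>
     (\<exists>m n. eval_kterm \<sigma> t = Some (NodeV m) \<and> eval_kterm \<sigma> u = Some (NodeV n) \<and>
        (m, n) \<in> leq A)"
| "sat_atomic A \<sigma> (RP \<rho> j m ts) \<longleftrightarrow>
     (\<exists>n\<in>nodes A. \<exists>\<alpha>. \<sigma> m = Some (NodeV n) \<and> instance_under \<alpha> \<rho> j n \<and>
        map (eval_kterm \<sigma>) ts = map (\<lambda>p. Some (MsgV (app \<alpha> p))) (role_params \<rho> j))"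

text \<open>
  The quantifiers are unsorted and range over all messages and all nodes of the protocol, not
  only the nodes of the skeleton.  A formula with a free variable outside \<open>dom \<sigma>\<close> is never
  satisfied; this applies to compound formulas, negations included.
\<close>

fun sat :: "'t trace set \<Rightarrow> 't skeleton \<Rightarrow> 't asg \<Rightarrow> 't form \<Rightarrow> bool" where
  "sat \<Pi> A \<sigma> (Atomic a) \<longleftrightarrow> fv (Atomic a) \<subseteq> dom \<sigma> \<and> sat_atomic A \<sigma> a"
| "sat \<Pi> A \<sigma> (Neg f) \<longleftrightarrow> fv (Neg f) \<subseteq> dom \<sigma> \<and> \<not> sat \<Pi> A \<sigma> f"
| "sat \<Pi> A \<sigma> (Conj fs) \<longleftrightarrow> fv (Conj fs) \<subseteq> dom \<sigma> \<and> (\<forall>f\<in>set fs. sat \<Pi> A \<sigma> f)"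
| "sat \<Pi> A \<sigma> (Disj fs) \<longleftrightarrow> fv (Disj fs) \<subseteq> dom \<sigma> \<and> (\<exists>f\<in>set fs. sat \<Pi> A \<sigma> f)"
| "sat \<Pi> A \<sigma> (Imp f g) \<longleftrightarrow> fv (Imp f g) \<subseteq> dom \<sigma> \<and> (sat \<Pi> A \<sigma> f \<longrightarrow> sat \<Pi> A \<sigma> g)"
| "sat \<Pi> A \<sigma> (All x f) \<longleftrightarrow>
     fv (All x f) \<subseteq> dom \<sigma> \<and> (\<forall>v\<in>vals \<Pi>. sat \<Pi> A (\<sigma>(x \<mapsto> v)) f)"
| "sat \<Pi> A \<sigma> (Ex x f) \<longleftrightarrow>
     fv (Ex x f) \<subseteq> dom \<sigma> \<and> (\<exists>v\<in>vals \<Pi>. sat \<Pi> A (\<sigma>(x \<mapsto> v)) f)"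

definition satisfiable :: "'t trace set \<Rightarrow> 't form \<Rightarrow> bool" where
  "satisfiable \<Pi> \<phi> \<longleftrightarrow> (\<exists>A \<sigma>. skeleton \<Pi> A \<and> assignment \<Pi> \<sigma> \<and> sat \<Pi> A \<sigma> \<phi>)"

definition satisfies :: "'t trace set \<Rightarrow> 't skeleton \<Rightarrow> 't form \<Rightarrow> bool" where
  "satisfies \<Pi> A G \<longleftrightarrow> (\<forall>\<sigma>. assignment \<Pi> \<sigma> \<longrightarrow> sat \<Pi> A \<sigma> G)"

definition achieves :: "'t trace set \<Rightarrow> 't form \<Rightarrow> bool" where
  "achieves \<Pi> G \<longleftrightarrow> (\<forall>A. realized \<Pi> A \<longrightarrow> satisfies \<Pi> A G)"


section \<open>Characteristic skeletons\<close>

text \<open>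
  \<open>hom_asg A H \<sigma>\<close> is the composition of \<open>H\<close> (with source \<open>A\<close>) and \<open>\<sigma>\<close>.  As \<open>H\<close> is defined on
  the nodes of \<open>A\<close> only, the composition is undefined where \<open>\<sigma>\<close> yields any other node.
\<close>

fun hom_val :: "'t skeleton \<Rightarrow> 't hom \<Rightarrow> 't val \<Rightarrow> 't val option" where
  "hom_val A H (MsgV t) = Some (MsgV (app (snd H) t))"
| "hom_val A H (NodeV n) = (if n \<in> nodes A then Some (NodeV (fst H n)) else None)"

definition hom_asg :: "'t skeleton \<Rightarrow> 't hom \<Rightarrow> 't asg \<Rightarrow> 't asg" where
  "hom_asg A H \<sigma> v = Option.bind (\<sigma> v) (hom_val A H)"

definition characteristic :: "'t trace set \<Rightarrow> 't form \<Rightarrow> 't skeleton \<Rightarrow> 't asg \<Rightarrow> bool" where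
  "characteristic \<Pi> \<phi> A \<sigma>' \<longleftrightarrow>
     skeleton \<Pi> A \<and> assignment \<Pi> \<sigma>' \<and> sat \<Pi> A \<sigma>' \<phi> \<and>
     (\<forall>B \<sigma>. skeleton \<Pi> B \<and> assignment \<Pi> \<sigma> \<and> sat \<Pi> B \<sigma> \<phi> \<longrightarrow>
        (\<exists>H. hom A B H \<and> \<sigma> |` fv \<phi> = hom_asg A H \<sigma>' \<and>
           (\<forall>H'. hom A B H' \<and> \<sigma> |` fv \<phi> = hom_asg A H' \<sigma>' \<longrightarrow> hom_eq A H H')))"

text \<open>
  \<open>extends_on xs \<tau> \<sigma>\<close>: \<open>\<tau>\<close> is \<open>\<sigma>\<close> extended so that it assigns a value to each variable of \<open>xs\<close>
  and to no other variable.  With \<open>xs\<close> the universally quantified variables of a goal and \<open>\<sigma>\<close>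
  the assignment that a shape induces on the free variables of the hypothesis, \<open>\<tau>\<close> is \<open>\<sigma>\<close>
  itself unless \<open>xs\<close> contains variables that do not occur in the hypothesis.
\<close>

definition extends_on :: "var list \<Rightarrow> 't asg \<Rightarrow> 't asg \<Rightarrow> bool" where
  "extends_on xs \<tau> \<sigma> \<longleftrightarrow> \<sigma> \<subseteq>\<^sub>m \<tau> \<and> dom \<tau> = set xs"

end

theory Submission
  imports Defs
begin

text \<open>
  Satisfaction of a disjunction of conjunctions of atomic formulas is preserved by homomorphisms,
  so the conclusion of the goal, once true at a shape, stays true in every realized skeleton above
  it.  The characteristic skeleton maps into every realized \<open>C\<close> satisfying the hypothesis,
  and this homomorphism factors through a shape.  Such a factorization exists because
  \<open>\<le>\<^sub>n\<close> is well-founded below \<open>C\<close>, up to isomorphism: going down, nodes and orderings can only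
  disappear, messages can only become smaller, and, when none of these changes, parameters can only
  be split further, of which there are boundedly many.  When nothing changes at all, the connecting
  homomorphism is invertible.
\<close>

section \<open>Messages\<close>

text \<open>Two obstacles stand behind the well-foundedness. A measure needs finite counts, but
  \<open>non\<close> and \<open>uniq\<close> may contain infinitely many atoms that occur in no
  message. The descent therefore runs among skeletons from which such atoms have been discarded, and
  the universal property of the characteristic skeleton relates these to the source. Moreover,
  injectivity on parameters does not make a homomorphism invertible: an indeterminate may become an
  atom, or an anonymous key pair the pair of a name, and no homomorphism leads back. A weight of
  messages registers both changes.

  Homomorphisms that count as equal agree only on parameters occurring in node messages of their
  source. Factoring through a shape thus preserves the value of a variable only if those parameters
  determine it. The condition that every argument in a security claim also appears in a role
  predicate guarantees this for the variables of \<phi>.\<close>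

lemma ingredient_params: "t \<sqsubseteq> u \<Longrightarrow> set (msg_params t) \<subseteq> set (msg_params u)"
  by (induction rule: ingredient.induct) auto

lemma param_cases:
  assumes "p \<in> set (msg_params t)"
  obtains a where "p = Atm a" | x where "p = Ind x"
  using assms by (induction t) auto

lemma app_eq_iff_params: "app \<alpha> t = app \<beta> t \<longleftrightarrow> (\<forall>p\<in>set (msg_params t). app \<alpha> p = app \<beta> p)"
  by (induction t) auto

lemma msg_params_app: "msg_params (app \<alpha> t) = concat (map (msg_params \<circ> app \<alpha>) (msg_params t))"
  by (induction t) auto

lemma msg_params_app_param:
  "p \<in> set (msg_params t) \<Longrightarrow> set (msg_params (app \<alpha> p)) \<subseteq> set (msg_params (app \<alpha> t))"
  by (subst (2) msg_params_app) auto

lemma app_mhom_comp [simp]: "app (mhom_comp \<beta> \<alpha>) t = app \<beta> (app \<alpha> t)"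
  by (induction t) (auto simp: mhom_comp_def)

lemma fst_mhom_comp [simp]: "fst (mhom_comp \<beta> \<alpha>) a = fst \<beta> (fst \<alpha> a)"
  by (simp add: mhom_comp_def)

lemma snd_mhom_comp [simp]: "snd (mhom_comp \<beta> \<alpha>) x = app \<beta> (snd \<alpha> x)"
  by (simp add: mhom_comp_def)

lemma app_ident [simp]: "app (id, Ind) t = t"
  by (induction t) auto

lemma atom_hom_comp: "atom_hom \<eta> \<Longrightarrow> atom_hom \<theta> \<Longrightarrow> atom_hom (\<theta> \<circ> \<eta>)"
  by (simp add: atom_hom_def option.map_comp)

lemma mhom_mhom_comp: "mhom \<alpha> \<Longrightarrow> mhom \<beta> \<Longrightarrow> mhom (mhom_comp \<beta> \<alpha>)"
  by (simp add: mhom_def mhom_comp_def atom_hom_comp)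

lemma mhom_ident [simp]: "mhom (id, Ind)"
  by (simp add: mhom_def atom_hom_def option.map_id)

lemma ingredient_app: "t \<sqsubseteq> u \<Longrightarrow> app \<alpha> t \<sqsubseteq> app \<alpha> u"
  by (induction rule: ingredient.induct) (auto intro: ingredient.intros)

lemma sk_atom_inj: "sk_atom a = Some c \<Longrightarrow> sk_atom b = Some c \<Longrightarrow> a = b"
  by (cases a; cases b) auto

lemma pk_atom_inj: "pk_atom a = Some c \<Longrightarrow> pk_atom b = Some c \<Longrightarrow> a = b"
  by (cases a; cases b) auto

lemma inv_atom_inj: "inv_atom a = Some c \<Longrightarrow> inv_atom b = Some c \<Longrightarrow> a = b"
  by (cases a; cases b) auto

lemma atom_hom_sk: "atom_hom \<eta> \<Longrightarrow> sk_atom (\<eta> a) = map_option \<eta> (sk_atom a)"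
  and atom_hom_pk: "atom_hom \<eta> \<Longrightarrow> pk_atom (\<eta> a) = map_option \<eta> (pk_atom a)"
  and atom_hom_inv: "atom_hom \<eta> \<Longrightarrow> inv_atom (\<eta> a) = map_option \<eta> (inv_atom a)"
  by (auto simp: atom_hom_def)

text \<open>Commuting with \<open>sk_atom\<close> and \<open>pk_atom\<close> settles the
  \<open>True\<close> halves, and key inversion carries this over to the \<open>False\<close>
  halves. So named pairs always go to named pairs of the same kind, and the image of a name fixes
  all four of its keys.\<close>

lemma atom_hom_Name:
  assumes "atom_hom \<eta>"
  obtains d where "\<eta> (Name c) = Name d" "\<And>h. \<eta> (AsymK (SigPair c) h) = AsymK (SigPair d) h"
    "\<And>h. \<eta> (AsymK (EncPair c) h) = AsymK (EncPair d) h"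
proof -
  have "sort_of (\<eta> (Name c)) = NameSort"
    using assms by (simp add: atom_hom_def)
  then obtain d where d: "\<eta> (Name c) = Name d"
    by (cases "\<eta> (Name c)") auto
  have 1: "\<eta> (AsymK (SigPair c) True) = AsymK (SigPair d) True"
    using atom_hom_sk [OF assms, of "Name c"] d by simp
  have 2: "\<eta> (AsymK (EncPair c) True) = AsymK (EncPair d) True"
    using atom_hom_pk [OF assms, of "Name c"] d by simp
  have 3: "\<eta> (AsymK (SigPair c) False) = AsymK (SigPair d) False"
    using atom_hom_inv [OF assms, of "AsymK (SigPair c) True"] 1 by simp
  have 4: "\<eta> (AsymK (EncPair c) False) = AsymK (EncPair d) False"
    using atom_hom_inv [OF assms, of "AsymK (EncPair c) True"] 2 by simp
  have "\<And>h. \<eta> (AsymK (SigPair c) h) = AsymK (SigPair d) h"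
    subgoal for h using 1 3 by (cases h) auto done
  moreover have "\<And>h. \<eta> (AsymK (EncPair c) h) = AsymK (EncPair d) h"
    subgoal for h using 2 4 by (cases h) auto done
  ultimately show thesis
    using d that by blast
qed

lemma atom_hom_AsymK_Not:
  assumes "atom_hom \<eta>" "\<eta> (AsymK b h) = AsymK c g"
  shows "\<eta> (AsymK b (\<not> h)) = AsymK c (\<not> g)"
  using atom_hom_inv [OF assms(1), of "AsymK b h"] assms(2) by simp

lemma atom_hom_sort: "atom_hom \<eta> \<Longrightarrow> sort_of (\<eta> a) = sort_of a"
  by (simp add: atom_hom_def)

section \<open>Inverting a homomorphism of messages\<close>

text \<open>
  The weights are chosen so that a homomorphism that preserves the weight of a message sends
  its indeterminates to indeterminates and its anonymous keys to anonymous keys.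
\<close>

fun atom_weight :: "atom \<Rightarrow> nat" where
  "atom_weight (AsymK (AnonPair _) _) = 2"
| "atom_weight (AsymK _ _) = 3"
| "atom_weight _ = 2"

primrec weight :: "'t msg \<Rightarrow> nat" where
  "weight (Atm a) = atom_weight a"
| "weight (Ind x) = 1"
| "weight (Enc t k) = Suc (weight t + weight k)"
| "weight (Cat g t u) = Suc (weight t + weight u)"

fun owner :: "atom \<Rightarrow> atom set" where
  "owner (AsymK (SigPair c) _) = {Name c}"
| "owner (AsymK (EncPair c) _) = {Name c}"
| "owner _ = {}"

text \<open>What an inverse homomorphism must control in order to act correctly on a given atom:
  both halves of a pair, and the owner, through which the value at a named key is forced. A name is
  closed by itself, since its value already fixes its keys.\<close>

fun atom_closure :: "atom \<Rightarrow> atom set" where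
  "atom_closure (AsymK b h) = {AsymK b h, AsymK b (\<not> h)} \<union> owner (AsymK b h)"
| "atom_closure a = {a}"

primrec closure :: "'t msg \<Rightarrow> 't msg set" where
  "closure (Atm a) = Atm ` atom_closure a"
| "closure (Ind x) = {Ind x}"
| "closure (Enc t k) = closure t \<union> closure k"
| "closure (Cat g t u) = closure t \<union> closure u"

lemma atom_weight_ge: "2 \<le> atom_weight a"
  by (cases a rule: atom_weight.cases) auto

lemma weight_ge_Suc0: "Suc 0 \<le> weight t"
  by (induction t) (auto intro: order_trans [OF _ atom_weight_ge])

text \<open>Only an anonymous pair can gain weight, by being sent to a named pair; all other atoms
  keep their kind. Equal weights thus mean that pairs and owners are carried over exactly.\<close>

lemma atom_hom_weight:
  assumes "atom_hom \<eta>"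
  shows "atom_weight a \<le> atom_weight (\<eta> a)"
    and "atom_weight (\<eta> a) = atom_weight a \<Longrightarrow> atom_closure (\<eta> a) = \<eta> ` atom_closure a"
    and "atom_weight (\<eta> a) = atom_weight a \<Longrightarrow> b \<in> atom_closure a \<Longrightarrow>
      atom_weight (\<eta> b) = atom_weight b"
proof -
  have s: "sort_of (\<eta> a) = sort_of a"
    by (rule atom_hom_sort [OF assms])
  have *: "atom_weight a \<le> atom_weight (\<eta> a) \<and>
      (atom_weight (\<eta> a) = atom_weight a \<longrightarrow>
        atom_closure (\<eta> a) = \<eta> ` atom_closure a \<and>
        (\<forall>b\<in>atom_closure a. atom_weight (\<eta> b) = atom_weight b))"
  proof (cases a)
    case (AsymK b h)
    then obtain c g where c: "\<eta> a = AsymK c g"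
      using s by (cases "\<eta> a") auto
    have n: "\<eta> (AsymK b (\<not> h)) = AsymK c (\<not> g)"
      using atom_hom_AsymK_Not [OF assms] c AsymK by blast
    show ?thesis
    proof (cases b)
      case (AnonPair p)
      then show ?thesis using AsymK c n by (cases c) auto
    next
      case (SigPair p)
      then show ?thesis using AsymK c n by (rule_tac c=p in atom_hom_Name [OF assms]) auto
    next
      case (EncPair p)
      then show ?thesis using AsymK c n by (rule_tac c=p in atom_hom_Name [OF assms]) auto
    qed
  qed (use s in \<open>cases "\<eta> a"; auto\<close>)+
  then show "atom_weight a \<le> atom_weight (\<eta> a)"
    and "atom_weight (\<eta> a) = atom_weight a \<Longrightarrow> atom_closure (\<eta> a) = \<eta> ` atom_closure a"
    and "atom_weight (\<eta> a) = atom_weight a \<Longrightarrow> b \<in> atom_closure a \<Longrightarrow>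
      atom_weight (\<eta> b) = atom_weight b"
    by auto
qed

lemma weight_app:
  assumes "mhom \<alpha>"
  shows "weight t \<le> weight (app \<alpha> t)"
  using assms by (induction t) (auto simp: mhom_def atom_hom_weight weight_ge_Suc0 intro: add_mono)

lemma weight_1: "weight t = Suc 0 \<Longrightarrow> \<exists>x. t = Ind x"
proof (cases t)
  case (Atm a)
  then show "weight t = Suc 0 \<Longrightarrow> ?thesis" using atom_weight_ge [of a] by simp
next
  case (Enc u k)
  then show "weight t = Suc 0 \<Longrightarrow> ?thesis" using weight_ge_Suc0 [of u] by simp
next
  case (Cat g u k)
  then show "weight t = Suc 0 \<Longrightarrow> ?thesis" using weight_ge_Suc0 [of u] by simp
qed auto

text \<open>The weights of parts can only grow, so equality for a whole message forces equality for
  every part, down to the parameters. An indeterminate whose weight stays 1 has become an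
  indeterminate.\<close>

lemma closure_app:
  assumes "mhom \<alpha>" "weight (app \<alpha> t) = weight t"
  shows "closure (app \<alpha> t) = app \<alpha> ` closure t"
  using assms(2)
proof (induction t)
  case (Atm a)
  then show ?case using assms(1) by (simp add: atom_hom_weight mhom_def image_image)
next
  case (Ind x)
  then show ?case by (auto dest: weight_1)
next
  case (Enc t k)
  then show ?case
    using weight_app [OF assms(1), of t] weight_app [OF assms(1), of k] by (auto simp: image_Un)
next
  case (Cat g t u)
  then show ?case
    using weight_app [OF assms(1), of t] weight_app [OF assms(1), of u] by (auto simp: image_Un)
qed

text \<open>The weights 2 and 3 of asymmetric keys are also the sizes of their closures: two halves,
  and the owner of a named pair. One weight thus bounds how far parameters can be split.\<close>

lemma card_atom_closure: "finite (atom_closure a) \<and> card (atom_closure a) \<le> atom_weight a"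
  by (cases a rule: atom_closure.cases; cases a rule: owner.cases) auto

lemma closure_card: "finite (closure t) \<and> card (closure t) \<le> weight t"
proof (induction t)
  case (Atm a)
  then show ?case using card_atom_closure [of a] by (auto simp: card_image inj_on_def)
next
  case (Enc t k)
  then show ?case using card_Un_le [of "closure t" "closure k"] by auto
next
  case (Cat g t u)
  then show ?case using card_Un_le [of "closure t" "closure u"] by auto
qed auto

lemma params_subset_closure: "set (msg_params t) \<subseteq> closure t"
proof (induction t)
  case (Atm a)
  then show ?case by (cases a rule: atom_closure.cases) auto
qed auto

lemma atom_closure_closed: "b \<in> atom_closure a \<Longrightarrow> atom_closure b \<subseteq> atom_closure a"
  by (cases a rule: owner.cases; cases b rule: owner.cases) auto

lemma closure_closed: "Atm a \<in> closure t \<Longrightarrow> Atm ` atom_closure a \<subseteq> closure t"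
proof (induction t)
  case (Atm b)
  then show ?case using atom_closure_closed [of a b] by auto
qed auto

lemma closure_weight:
  assumes "mhom \<alpha>" "weight (app \<alpha> t) = weight t" "c \<in> closure t"
  shows "weight (app \<alpha> c) = weight c"
  using assms(2,3)
proof (induction t)
  case (Atm a)
  then show ?case using assms(1) atom_hom_weight(3) by (auto simp: mhom_def)
next
  case (Enc t k)
  then show ?case
    using weight_app [OF assms(1), of t] weight_app [OF assms(1), of k] by auto
next
  case (Cat g t u)
  then show ?case
    using weight_app [OF assms(1), of t] weight_app [OF assms(1), of u] by auto
qed auto

text \<open>The plain inverse of \<eta> on \<open>S\<close>, completed by the identity, need not
  commute with the operators: the image may contain a name without its keys. Named keys are
  therefore sent where their owner goes, which is correct on the image because \<open>S\<close>
  contains the owners. Preservation of weights keeps anonymous keys anonymous, and on those the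
  plain inverse is used.\<close>

lemma atom_hom_inverse:
  assumes \<eta>: "atom_hom \<eta>"
    and inj: "inj_on \<eta> S"
    and closed: "\<And>a. a \<in> S \<Longrightarrow> atom_closure a \<subseteq> S"
    and weight: "\<And>a. a \<in> S \<Longrightarrow> atom_weight (\<eta> a) = atom_weight a"
  obtains \<theta> where "atom_hom \<theta>" "\<And>a. a \<in> S \<Longrightarrow> \<theta> (\<eta> a) = a"
proof -
  define g where "g b = (if b \<in> \<eta> ` S then inv_into S \<eta> b else b)" for b
  have g: "g (\<eta> a) = a" if "a \<in> S" for a
    using that inj by (simp add: g_def)
  have g_sort: "sort_of (g b) = sort_of b" for b
    using atom_hom_sort [OF \<eta>] by (auto simp: g_def inv_into_f_f inj)
  have "\<forall>d. \<exists>e. g (Name d) = Name e"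
  proof
    fix d
    show "\<exists>e. g (Name d) = Name e"
      using g_sort [of "Name d"] by (cases "g (Name d)") auto
  qed
  then obtain nm where nm: "\<And>d. g (Name d) = Name (nm d)"
    by metis
  define \<theta> where "\<theta> b = (case b of AsymK (SigPair d) h \<Rightarrow> AsymK (SigPair (nm d)) h
    | AsymK (EncPair d) h \<Rightarrow> AsymK (EncPair (nm d)) h | _ \<Rightarrow> g b)" for b
  \<comment> \<open>As \<open>S\<close> is closed under key inversion, the image contains both
    halves of an anonymous pair or neither. So \<open>g\<close> inverts \<eta> on both or is the
    identity on both.\<close>
  have g_inv: "inv_atom (g (AsymK (AnonPair q) h)) = Some (g (AsymK (AnonPair q) (\<not> h)))" for q h
  proof -
    have *: "g (AsymK (AnonPair q) (\<not> h)) = AsymK b (\<not> k) \<and> g (AsymK (AnonPair q) h) = AsymK b k"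
      if "AsymK b k \<in> S" "\<eta> (AsymK b k) = AsymK (AnonPair q) h" for b k h
    proof -
      have "AsymK b (\<not> k) \<in> S"
        using closed [OF that(1)] by simp
      then show ?thesis
        using g that atom_hom_AsymK_Not [OF \<eta> that(2)] by metis
    qed
    have im: "\<exists>b k. AsymK b k \<in> S \<and> \<eta> (AsymK b k) = AsymK (AnonPair q) h"
      if m: "AsymK (AnonPair q) h \<in> \<eta> ` S" for h
    proof -
      obtain a where a: "a \<in> S" "AsymK (AnonPair q) h = \<eta> a"
        using m by blast
      then have "sort_of a = AsymSort"
        using atom_hom_sort [OF \<eta>, of a] by (metis sort_of.simps(5))
      then obtain b k where "a = AsymK b k"
        by (cases a) auto
      then show ?thesis using a by metis
    qed
    show ?thesis
    proof (cases "AsymK (AnonPair q) h \<in> \<eta> ` S \<or> AsymK (AnonPair q) (\<not> h) \<in> \<eta> ` S")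
      case True
      then consider b k where "AsymK b k \<in> S" "\<eta> (AsymK b k) = AsymK (AnonPair q) h"
        | b k where "AsymK b k \<in> S" "\<eta> (AsymK b k) = AsymK (AnonPair q) (\<not> h)"
        using im by blast
      then show ?thesis
        by cases (auto dest: *)
    next
      case False
      then show ?thesis by (simp add: g_def)
    qed
  qed
  have sort: "sort_of (\<theta> b) = sort_of b" for b
    using g_sort [of b] by (auto simp: \<theta>_def split: atom.split keypair.split)
  have None: "sk_atom b = None \<and> pk_atom b = None" if "sort_of b \<noteq> NameSort" for b
    using that by (cases b) auto
  have inv_None: "inv_atom b = None" if "sort_of b \<in> {NonceSort, TextSort, NameSort}" for b
    using that by (cases b) auto
  have inv_Sym: "inv_atom b = Some b" if "sort_of b = SymSort" for b
    using that by (cases b) auto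
  have "atom_hom \<theta>"
    unfolding atom_hom_def
  proof (intro conjI allI)
    fix b
    show "sort_of (\<theta> b) = sort_of b" by (rule sort)
    show "sk_atom (\<theta> b) = map_option \<theta> (sk_atom b)"
      using None [of b] None [of "\<theta> b"] sort [of b] by (cases b) (auto simp: \<theta>_def nm)
    show "pk_atom (\<theta> b) = map_option \<theta> (pk_atom b)"
      using None [of b] None [of "\<theta> b"] sort [of b] by (cases b) (auto simp: \<theta>_def nm)
    show "inv_atom (\<theta> b) = map_option \<theta> (inv_atom b)"
    proof (cases b)
      case (AsymK c h)
      then show ?thesis using g_inv by (cases c) (auto simp: \<theta>_def)
    qed (use inv_None [of "\<theta> b"] inv_Sym [of "\<theta> b"] sort [of b] in auto)
  qed
  moreover have "\<theta> (\<eta> a) = a" if "a \<in> S" for a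
  proof (cases a)
    case (AsymK c h)
    show ?thesis
    proof (cases c)
      case (AnonPair p)
      have "sort_of (\<eta> a) = AsymSort" "atom_weight (\<eta> a) = 2"
        using atom_hom_sort [OF \<eta>, of a] weight [OF that] AsymK AnonPair by auto
      then obtain q k where "\<eta> a = AsymK (AnonPair q) k"
        by (cases "\<eta> a" rule: atom_weight.cases) auto
      then show ?thesis using g [OF that] by (simp add: \<theta>_def)
    next
      case (SigPair p)
      then have "Name p \<in> S" using closed [OF that] AsymK by simp
      then show ?thesis
        using g [of "Name p"] AsymK SigPair nm
        by (rule_tac c=p in atom_hom_Name [OF \<eta>]) (auto simp: \<theta>_def)
    next
      case (EncPair p)
      then have "Name p \<in> S" using closed [OF that] AsymK by simp
      then show ?thesis
        using g [of "Name p"] AsymK EncPair nm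
        by (rule_tac c=p in atom_hom_Name [OF \<eta>]) (auto simp: \<theta>_def)
    qed
  qed (use g [OF that] atom_hom_sort [OF \<eta>, of a] in
      \<open>auto simp: \<theta>_def split: atom.split keypair.split\<close>)
  ultimately show thesis using that by blast
qed

text \<open>By weight, indeterminates stay indeterminates, so atoms and indeterminates can be
  inverted separately. Injectivity is required on closures because atoms must be inverted on whole
  pairs together with their owners.\<close>

lemma mhom_inverse:
  assumes \<alpha>: "mhom \<alpha>"
    and weight: "\<And>t. t \<in> T \<Longrightarrow> weight (app \<alpha> t) = weight t"
    and inj: "inj_on (app \<alpha>) (\<Union>t\<in>T. closure t)"
  obtains \<beta> where "mhom \<beta>" "\<And>t. t \<in> T \<Longrightarrow> app \<beta> (app \<alpha> t) = t"
proof -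
  define C where "C = (\<Union>t\<in>T. closure t)"
  have inj: "inj_on (app \<alpha>) C"
    using inj by (simp add: C_def)
  have wC: "weight (app \<alpha> c) = weight c" if "c \<in> C" for c
    using that closure_weight [OF \<alpha>] weight by (auto simp: C_def)
  define S where "S = {a. Atm a \<in> C}"
  have "inj_on (fst \<alpha>) S"
    using inj_onD [OF inj, of "Atm _" "Atm _"] by (auto simp: inj_on_def S_def)
  moreover have "atom_closure a \<subseteq> S" if "a \<in> S" for a
    using that closure_closed by (fastforce simp: S_def C_def)
  moreover have "atom_weight (fst \<alpha> a) = atom_weight a" if "a \<in> S" for a
    using that wC [of "Atm a"] by (simp add: S_def)
  ultimately obtain \<theta> where \<theta>: "atom_hom \<theta>" "\<And>a. a \<in> S \<Longrightarrow> \<theta> (fst \<alpha> a) = a"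
    using atom_hom_inverse \<alpha> unfolding mhom_def by blast
  define \<chi> where "\<chi> y = (if Ind y \<in> app \<alpha> ` C then inv_into C (app \<alpha>) (Ind y) else Ind y)" for y
  have \<chi>: "app (\<theta>, \<chi>) (app \<alpha> (Ind x)) = Ind x" if x: "Ind x \<in> C" for x
  proof -
    obtain y where y: "app \<alpha> (Ind x) = Ind y"
      using wC [OF x] weight_1 [of "app \<alpha> (Ind x)"] by auto
    then show ?thesis
      using inv_into_f_f [OF inj x] imageI [OF x, of "app \<alpha>"] by (simp add: \<chi>_def)
  qed
  have "app (\<theta>, \<chi>) (app \<alpha> t) = t" if "t \<in> T" for t
  proof -
    have "app (mhom_comp (\<theta>, \<chi>) \<alpha>) t = app (id, Ind) t"
    proof (rule app_eq_iff_params [THEN iffD2], rule ballI)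
      fix p
      assume p: "p \<in> set (msg_params t)"
      then have "p \<in> C"
        using params_subset_closure that by (auto simp: C_def)
      then show "app (mhom_comp (\<theta>, \<chi>) \<alpha>) p = app (id, Ind) p"
        using p \<theta>(2) \<chi> by (elim param_cases) (auto simp: S_def)
    qed
    then show ?thesis by simp
  qed
  then show thesis
    using that [of "(\<theta>, \<chi>)"] \<theta>(1) by (simp add: mhom_def)
qed

section \<open>Skeletons and their homomorphisms\<close>

lemma skeleton_nodes:
  assumes "skeleton \<Pi> A"
  shows "finite (nodes A)" "nodes A \<subseteq> nodes_of \<Pi>" "leq A \<subseteq> nodes A \<times> nodes A" "finite (leq A)"
proof -
  show "finite (nodes A)" "nodes A \<subseteq> nodes_of \<Pi>" "leq A \<subseteq> nodes A \<times> nodes A"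
    using assms by (auto simp: skeleton_def dest: partial_order_onD(4))
  then show "finite (leq A)"
    by (meson finite_SigmaI finite_subset)
qed

lemma skeleton_is_node: "skeleton \<Pi> A \<Longrightarrow> n \<in> nodes A \<Longrightarrow> is_node n"
  using skeleton_nodes(2) by (fastforce simp: nodes_of_def instance_under_def)

lemma skeleton_succ: "skeleton \<Pi> A \<Longrightarrow> n \<in> nodes A \<Longrightarrow> succ m n \<Longrightarrow> m \<in> nodes A"
  unfolding skeleton_def by blast

lemma skeleton_succ_trancl: "skeleton \<Pi> A \<Longrightarrow> succ\<^sup>+\<^sup>+ m n \<Longrightarrow> n \<in> nodes A \<Longrightarrow> m \<in> nodes A"
  by (rotate_tac 1, induction rule: tranclp_induct) (auto dest: skeleton_succ)

lemma skeleton_prefix: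
  assumes A: "skeleton \<Pi> A" and n: "(s, i) \<in> nodes A" and j: "1 \<le> j" "j \<le> i"
  shows "(s, j) \<in> nodes A"
  using j(2,1)
proof (induction rule: inc_induct)
  case (step m)
  have "succ (s, m) (s, Suc m)"
    using skeleton_is_node [OF A n] step by (auto simp: succ_def is_node_def)
  then show ?case
    using step skeleton_succ [OF A] by auto
qed (rule n)

lemma hom_iff:
  "hom A B H \<longleftrightarrow> mhom (snd H) \<and> fst H ` nodes A \<subseteq> nodes B \<and>
     (\<forall>n\<in>nodes A. node_msg (fst H n) = app (snd H) (node_msg n) \<and> node_dir (fst H n) = node_dir n) \<and>
     (\<forall>s i. (s, i) \<in> nodes A \<longrightarrow> (\<exists>s'. \<forall>j. 1 \<le> j \<and> j \<le> i \<longrightarrow> fst H (s, j) = (s', j))) \<and>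
     (\<forall>n m. (n, m) \<in> leq A \<longrightarrow> (fst H n, fst H m) \<in> leq B) \<and>
     fst (snd H) ` non A \<subseteq> non B \<and> fst (snd H) ` uniq A \<subseteq> uniq B \<and>
     (\<forall>a\<in>uniq A. \<forall>n\<in>nodes A.
        originates (Atm a) n \<longrightarrow> originates (Atm (fst (snd H) a)) (fst H n))"
  by (simp add: hom_def split_beta)

lemma
  assumes "hom A B H"
  shows hom_mhom: "mhom (snd H)"
    and hom_node: "n \<in> nodes A \<Longrightarrow> fst H n \<in> nodes B"
    and hom_msg: "n \<in> nodes A \<Longrightarrow> node_msg (fst H n) = app (snd H) (node_msg n)"
    and hom_dir: "n \<in> nodes A \<Longrightarrow> node_dir (fst H n) = node_dir n"
    and hom_strand: "(s, i) \<in> nodes A \<Longrightarrow> \<exists>s'. \<forall>j. 1 \<le> j \<and> j \<le> i \<longrightarrow> fst H (s, j) = (s', j)"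
    and hom_leq: "(n, m) \<in> leq A \<Longrightarrow> (fst H n, fst H m) \<in> leq B"
    and hom_non: "a \<in> non A \<Longrightarrow> fst (snd H) a \<in> non B"
    and hom_uniq: "a \<in> uniq A \<Longrightarrow> fst (snd H) a \<in> uniq B"
    and hom_originates: "a \<in> uniq A \<Longrightarrow> n \<in> nodes A \<Longrightarrow> originates (Atm a) n \<Longrightarrow>
      originates (Atm (fst (snd H) a)) (fst H n)"
  using assms unfolding hom_iff image_subset_iff
  by (elim conjE; simp only: simp_thms; (iprover | meson))+

lemma fst_hom_comp [simp]: "fst (hom_comp K H) n = fst K (fst H n)"
  and snd_hom_comp [simp]: "snd (hom_comp K H) = mhom_comp (snd K) (snd H)"
  by (simp_all add: hom_comp_def)

lemma hom_hom_comp: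
  assumes A: "skeleton \<Pi> A" and H: "hom A B H" and K: "hom B C K"
  shows "hom A C (hom_comp K H)"
proof -
  have "\<exists>s'. \<forall>j. 1 \<le> j \<and> j \<le> i \<longrightarrow> fst (hom_comp K H) (s, j) = (s', j)" if n: "(s, i) \<in> nodes A" for s i
  proof -
    obtain s' where s': "\<And>j. 1 \<le> j \<Longrightarrow> j \<le> i \<Longrightarrow> fst H (s, j) = (s', j)"
      using hom_strand [OF H n] by blast
    moreover have "1 \<le> i"
      using skeleton_is_node [OF A n] by (simp add: is_node_def)
    ultimately have "(s', i) \<in> nodes B"
      using hom_node [OF H n] by simp
    then obtain s'' where "\<And>j. 1 \<le> j \<Longrightarrow> j \<le> i \<Longrightarrow> fst K (s', j) = (s'', j)"
      using hom_strand [OF K] by blast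
    then show ?thesis
      using s' by (intro exI [of _ s'']) simp
  qed
  moreover have "mhom (snd (hom_comp K H))"
    using H K by (simp add: hom_mhom mhom_mhom_comp)
  ultimately show ?thesis
    unfolding hom_iff [of A C]
    using hom_node [OF H] hom_node [OF K] hom_msg [OF H] hom_msg [OF K] hom_dir [OF H] hom_dir [OF K]
      hom_leq [OF H] hom_leq [OF K] hom_non [OF H] hom_non [OF K] hom_uniq [OF H] hom_uniq [OF K]
      hom_originates [OF H] hom_originates [OF K]
    by (simp add: image_subset_iff)
qed

abbreviation hom_ident :: "'t hom" where
  "hom_ident \<equiv> (id, (id, Ind))"

text \<open>Agreement on a message is agreement on its parameters, and these include the parameters
  of all its ingredients and of the keys used in it.\<close>

lemma hom_eq_iff:
  "hom_eq A H H' \<longleftrightarrow> (\<forall>n\<in>nodes A. fst H n = fst H' n) \<and>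
     (\<forall>n\<in>nodes A. app (snd H) (node_msg n) = app (snd H') (node_msg n))"
proof -
  have "app (snd H) a = app (snd H') a"
    if eq: "app (snd H) t = app (snd H') t" and a: "a \<sqsubseteq> t \<or> (\<exists>u. Enc u a \<sqsubseteq> t)" for a t
  proof -
    have "set (msg_params a) \<subseteq> set (msg_params t)"
      using a ingredient_params by fastforce
    then show ?thesis
      using eq app_eq_iff_params by blast
  qed
  then show ?thesis
    unfolding hom_eq_def by (blast intro: ingredient_refl)
qed

lemma hom_eq_node: "hom_eq A H H' \<Longrightarrow> n \<in> nodes A \<Longrightarrow> fst H n = fst H' n"
  and hom_eq_msg: "hom_eq A H H' \<Longrightarrow> n \<in> nodes A \<Longrightarrow>
    app (snd H) (node_msg n) = app (snd H') (node_msg n)"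
  by (auto simp: hom_eq_iff)

lemma hom_eq_sym: "hom_eq A H H' \<Longrightarrow> hom_eq A H' H"
  by (simp add: hom_eq_iff)

lemma hom_eq_trans: "hom_eq A H H' \<Longrightarrow> hom_eq A H' H'' \<Longrightarrow> hom_eq A H H''"
  by (simp add: hom_eq_iff)

lemma hom_eq_comp_left: "hom_eq A H H' \<Longrightarrow> hom_eq A (hom_comp K H) (hom_comp K H')"
  by (simp add: hom_eq_iff)

lemma hom_eq_comp_right:
  assumes H: "hom A B H" and K: "hom_eq B K K'"
  shows "hom_eq A (hom_comp K H) (hom_comp K' H)"
proof -
  have "fst K (fst H n) = fst K' (fst H n) \<and>
      app (snd K) (app (snd H) (node_msg n)) = app (snd K') (app (snd H) (node_msg n))"
    if "n \<in> nodes A" for n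
    using hom_eq_node [OF K hom_node [OF H that]] hom_eq_msg [OF K hom_node [OF H that]]
      hom_msg [OF H that] by simp
  then show ?thesis
    unfolding hom_eq_iff fst_hom_comp snd_hom_comp app_mhom_comp by blast
qed

lemma hom_comp_assoc: "hom_comp L (hom_comp K H) = hom_comp (hom_comp L K) H"
  by (auto simp: hom_comp_def mhom_comp_def fun_eq_iff simp flip: app_mhom_comp)

lemma hom_comp_ident [simp]: "hom_comp hom_ident H = H" "hom_comp H hom_ident = H"
  by (cases H; auto simp: hom_comp_def mhom_comp_def fun_eq_iff)+

lemma succ_hom:
  assumes A: "skeleton \<Pi> A" and B: "skeleton \<Pi> B" and H: "hom A B H"
    and n: "n \<in> nodes A" and m: "succ m n"
  shows "succ (fst H m) (fst H n)"
proof -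
  obtain s i where ni: "n = (s, i)"
    by (cases n)
  obtain s' where s': "\<And>j. 1 \<le> j \<Longrightarrow> j \<le> i \<Longrightarrow> fst H (s, j) = (s', j)"
    using hom_strand [OF H] n ni by blast
  have "is_node (fst H m)" "is_node (fst H n)"
    using skeleton_is_node [OF B] hom_node [OF H] skeleton_succ [OF A n m] n by auto
  moreover obtain k where "m = (s, k)" "1 \<le> k" "i = Suc k"
    using m ni by (cases m) (auto simp: succ_def is_node_def)
  ultimately show ?thesis
    using s' [of k] s' [of i] ni by (simp add: succ_def)
qed

lemma succ_trancl_hom:
  assumes A: "skeleton \<Pi> A" and B: "skeleton \<Pi> B" and H: "hom A B H"
    and m: "succ\<^sup>+\<^sup>+ m n" and n: "n \<in> nodes A"
  shows "succ\<^sup>+\<^sup>+ (fst H m) (fst H n)"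
  using m n
proof (induction rule: tranclp_induct)
  case (base n)
  then show ?case using succ_hom [OF A B H] by blast
next
  case (step k n)
  then show ?case
    using succ_hom [OF A B H] skeleton_succ [OF A] by (meson tranclp.trancl_into_trancl)
qed

section \<open>Occurring parameters and the removal of atoms that do not occur\<close>

definition occurring :: "'t skeleton \<Rightarrow> 't msg set" where
  "occurring A = (\<Union>n\<in>nodes A. set (msg_params (node_msg n)))"

lemma hom_eq_occurring: "hom_eq A H H' \<Longrightarrow> p \<in> occurring A \<Longrightarrow> app (snd H) p = app (snd H') p"
  unfolding hom_eq_iff occurring_def by (blast dest: app_eq_iff_params [THEN iffD1])

lemma hom_occurring:
  assumes H: "hom A B H" and a: "Atm a \<in> occurring A"
  shows "Atm (fst (snd H) a) \<in> occurring B"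
proof -
  obtain n where n: "n \<in> nodes A" "Atm a \<in> set (msg_params (node_msg n))"
    using a by (auto simp: occurring_def)
  then have "Atm (fst (snd H) a) \<in> set (msg_params (node_msg (fst H n)))"
    using msg_params_app_param [OF n(2), of "snd H"] hom_msg [OF H n(1)] by auto
  then show ?thesis
    using hom_node [OF H n(1)] by (auto simp: occurring_def)
qed

definition trimmed :: "'t skeleton \<Rightarrow> bool" where
  "trimmed A \<longleftrightarrow> Atm ` (non A \<union> uniq A) \<subseteq> occurring A"

text \<open>Only finitely many parameters occur in the messages of a skeleton, so what remains of
  \<open>non\<close> and \<open>uniq\<close> can be counted.\<close>

definition trim :: "'t skeleton \<Rightarrow> 't skeleton" where
  "trim A = A\<lparr>non := {a \<in> non A. Atm a \<in> occurring A}, uniq := {a \<in> uniq A. Atm a \<in> occurring A}\<rparr>"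

lemma trim_simps [simp]:
  "nodes (trim A) = nodes A" "leq (trim A) = leq A" "occurring (trim A) = occurring A"
  "non (trim A) = {a \<in> non A. Atm a \<in> occurring A}"
  "uniq (trim A) = {a \<in> uniq A. Atm a \<in> occurring A}"
  by (simp_all add: trim_def occurring_def)

lemma trimmed_trim: "trimmed (trim A)"
  by (auto simp: trimmed_def)

lemma skeleton_trim: "skeleton \<Pi> A \<Longrightarrow> skeleton \<Pi> (trim A)"
  unfolding skeleton_def trim_simps by blast

lemma derivable_mono: "derivable S t \<Longrightarrow> S \<subseteq> T \<Longrightarrow> derivable T t"
  by (induction rule: derivable.induct) (auto intro: derivable.intros)

text \<open>A discarded atom becomes freely available to the adversary, so the inputs only
  grow.\<close>

lemma realized_trim:
  assumes "realized \<Pi> A"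
  shows "realized \<Pi> (trim A)"
proof -
  have "adversary_inputs A n \<subseteq> adversary_inputs (trim A) n" for n
    by (auto simp: adversary_inputs_def)
  then show ?thesis
    using assms skeleton_trim derivable_mono unfolding realized_def trim_simps by metis
qed

lemma hom_trim:
  assumes "hom A B H"
  shows "hom (trim A) (trim B) H"
  using assms hom_occurring [OF assms] unfolding hom_iff by (simp add: image_subset_iff)

lemma hom_untrim: "hom A (trim B) H \<Longrightarrow> hom A B H"
  unfolding hom_iff by (auto simp: image_subset_iff)

lemma hom_ident: "hom A A hom_ident"
  by (auto simp: hom_iff)

lemma hom_of_trim: "hom (trim A) A hom_ident"
  using hom_untrim hom_ident by blast

text \<open>As \<open>A\<close> is trimmed, each declared atom occurs in some message. Hence
  \<beta>, which undoes \<open>snd J\<close> on node messages, also undoes it on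
  \<open>non A\<close> and \<open>uniq A\<close>.\<close>

lemma hom_inverse:
  assumes A: "skeleton \<Pi> A" and B: "skeleton \<Pi> B" and J: "hom A B J" and trimmed: "trimmed A"
    and bij: "bij_betw (fst J) (nodes A) (nodes B)"
    and leq: "leq B \<subseteq> map_prod (fst J) (fst J) ` leq A"
    and non: "non B \<subseteq> fst (snd J) ` non A" and uniq: "uniq B \<subseteq> fst (snd J) ` uniq A"
    and \<beta>: "mhom \<beta>" "\<And>n. n \<in> nodes A \<Longrightarrow> app \<beta> (app (snd J) (node_msg n)) = node_msg n"
  obtains J' where "hom B A J'" "nodewise_injective B J'" "hom_eq A (hom_comp J' J) hom_ident"
proof -
  define \<zeta> where "\<zeta> = inv_into (nodes A) (fst J)"
  have \<zeta>: "\<zeta> (fst J n) = n" if "n \<in> nodes A" for n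
    using that bij by (simp add: \<zeta>_def bij_betw_def)
  have preimage: "\<exists>m\<in>nodes A. n = fst J m" if "n \<in> nodes B" for n
    using that bij by (auto simp: bij_betw_def)
  have eq: "hom_eq A (hom_comp (\<zeta>, \<beta>) J) hom_ident"
    using \<zeta> \<beta>(2) by (simp add: hom_eq_iff)
  have atom: "fst \<beta> (fst (snd J) a) = a" if "Atm a \<in> occurring A" for a
    using hom_eq_occurring [OF eq that] by simp
  have occ: "Atm a \<in> occurring A" if "a \<in> non A \<union> uniq A" for a
    using that trimmed by (auto simp: trimmed_def)
  have inj: "nodewise_injective B (\<zeta>, \<beta>)"
    using bij by (simp add: nodewise_injective_def \<zeta>_def bij_betw_def inj_on_inv_into)
  have strand: "\<exists>s'. \<forall>j. 1 \<le> j \<and> j \<le> i \<longrightarrow> \<zeta> (s, j) = (s', j)" if n: "(s, i) \<in> nodes B" for s i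
  proof -
    obtain s' i' where m: "(s', i') \<in> nodes A" "(s, i) = fst J (s', i')"
      using preimage [OF n] by auto
    obtain s'' where s'': "\<And>j. 1 \<le> j \<Longrightarrow> j \<le> i' \<Longrightarrow> fst J (s', j) = (s'', j)"
      using hom_strand [OF J m(1)] by blast
    moreover have "1 \<le> i'"
      using skeleton_is_node [OF A m(1)] by (simp add: is_node_def)
    ultimately have "s = s''" "i = i'"
      using m(2) by auto
    then have "\<zeta> (s, j) = (s', j)" if "1 \<le> j" "j \<le> i" for j
      using \<zeta> [of "(s', j)"] s'' [of j] skeleton_prefix [OF A m(1)] that by simp
    then show ?thesis by blast
  qed
  have orig: "originates (Atm (fst \<beta> a)) (\<zeta> n)"
    if a: "a \<in> uniq B" and n: "n \<in> nodes B" and o: "originates (Atm a) n" for a n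
  proof -
    obtain b where b: "b \<in> uniq A" "a = fst (snd J) b"
      using a uniq by auto
    obtain m where m: "m \<in> nodes A" "n = fst J m"
      using preimage [OF n] by blast
    have "app \<beta> (Atm a) \<sqsubseteq> app \<beta> (node_msg n)"
      using o by (intro ingredient_app) (simp add: originates_def)
    then have "Atm b \<sqsubseteq> node_msg m"
      using m b atom occ \<beta>(2) hom_msg [OF J] by simp
    \<comment> \<open>\<open>J\<close> would carry an earlier occurrence of \<open>b\<close> on the
      strand to an earlier occurrence of \<open>a\<close>, contradicting that \<open>a\<close>
      originates at \<open>n\<close>.\<close>
    moreover have "\<not> Atm b \<sqsubseteq> node_msg k" if k: "succ\<^sup>+\<^sup>+ k m" for k
    proof
      assume "Atm b \<sqsubseteq> node_msg k"
      then have "Atm a \<sqsubseteq> node_msg (fst J k)"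
        using ingredient_app [of "Atm b" "node_msg k" "snd J"] hom_msg [OF J] b m k
          skeleton_succ_trancl [OF A] by simp
      then show False
        using succ_trancl_hom [OF A B J k m(1)] o m(2) unfolding originates_def by blast
    qed
    moreover have "node_dir m = Transmission"
      using o hom_dir [OF J m(1)] m(2) by (simp add: originates_def)
    moreover have "fst \<beta> a = b" "\<zeta> n = m"
      using m b atom occ \<zeta> by simp_all
    ultimately show ?thesis
      unfolding originates_def by blast
  qed
  have "hom B A (\<zeta>, \<beta>)"
    unfolding hom_iff fst_conv snd_conv
  proof (intro conjI ballI)
    show "\<zeta> ` nodes B \<subseteq> nodes A"
      using bij_betw_inv_into [OF bij] by (simp add: \<zeta>_def bij_betw_def)
    fix n
    assume "n \<in> nodes B"
    then obtain m where m: "m \<in> nodes A" "n = fst J m"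
      using preimage by blast
    then have "\<zeta> n = m"
      using \<zeta> by simp
    then show "node_msg (\<zeta> n) = app \<beta> (node_msg n)" "node_dir (\<zeta> n) = node_dir n"
      using m \<beta>(2) [OF m(1)] hom_msg [OF J m(1)] hom_dir [OF J m(1)] by simp_all
  next
    show "\<forall>n m. (n, m) \<in> leq B \<longrightarrow> (\<zeta> n, \<zeta> m) \<in> leq A"
    proof (intro allI impI)
      fix n m
      assume "(n, m) \<in> leq B"
      from subsetD [OF leq this] obtain p where p: "(n, m) = map_prod (fst J) (fst J) p" "p \<in> leq A"
        by (rule imageE)
      obtain n' m' where n'm': "p = (n', m')"
        by (cases p)
      then have "n' \<in> nodes A" "m' \<in> nodes A"
        using subsetD [OF skeleton_nodes(3) [OF A] p(2)] by simp_all
      then show "(\<zeta> n, \<zeta> m) \<in> leq A"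
        using \<zeta> p n'm' by simp
    qed
    show "fst \<beta> ` non B \<subseteq> non A" "fst \<beta> ` uniq B \<subseteq> uniq A"
      using image_mono [OF non, of "fst \<beta>"] image_mono [OF uniq, of "fst \<beta>"] atom [OF occ]
      by (simp_all add: image_image)
  qed (use \<beta>(1) strand orig in auto)
  then show thesis
    using that inj eq by blast
qed

section \<open>Existence of shapes\<close>

definition total_weight :: "'t skeleton \<Rightarrow> nat" where
  "total_weight A = (\<Sum>n\<in>nodes A. weight (node_msg n))"

definition total_closure :: "'t skeleton \<Rightarrow> 't msg set" where
  "total_closure A = (\<Union>n\<in>nodes A. closure (node_msg n))"

text \<open>
  Among trimmed skeletons, going down along \<open>\<le>\<^sub>n\<close> never increases this measure: undoing an
  identification of parameters enlarges the closure, whose size is bounded by the weight.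
\<close>

definition generality :: "'t skeleton rel" where
  "generality = measures
     [\<lambda>A. card (leq A) + total_weight A,
      \<lambda>A. total_weight A - card (total_closure A),
      \<lambda>A. card (non A) + card (uniq A)]"

lemma card_total_closure:
  assumes "finite (nodes A)"
  shows "finite (total_closure A)" "card (total_closure A) \<le> total_weight A"
proof -
  show "finite (total_closure A)"
    using assms closure_card by (auto simp: total_closure_def)
  have "card (total_closure A) \<le> (\<Sum>n\<in>nodes A. card (closure (node_msg n)))"
    unfolding total_closure_def by (rule card_UN_le [OF assms])
  also have "\<dots> \<le> total_weight A"
    unfolding total_weight_def using closure_card by (intro sum_mono) blast
  finally show "card (total_closure A) \<le> total_weight A" .
qed

lemma finite_trimmed:
  fixes A :: "'t skeleton"
  assumes "skeleton \<Pi> A" "trimmed A"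
  shows "finite (non A)" "finite (uniq A)"
proof -
  have "finite (occurring A)"
    using skeleton_nodes(1) [OF assms(1)] by (simp add: occurring_def)
  then have "finite ((Atm :: atom \<Rightarrow> 't msg) ` (non A \<union> uniq A))"
    by (rule finite_subset [OF assms(2) [unfolded trimmed_def]])
  then have "finite (non A \<union> uniq A)"
    by (rule finite_imageD) (simp add: inj_on_def)
  then show "finite (non A)" "finite (uniq A)"
    by simp_all
qed

lemma inj_on_leq:
  assumes "skeleton \<Pi> A" "nodewise_injective A J"
  shows "inj_on (map_prod (fst J) (fst J)) (leq A)"
  using assms(2) skeleton_nodes(3) [OF assms(1)]
  by (auto simp: nodewise_injective_def intro: map_prod_inj_on [THEN inj_on_subset])

lemma card_leq_le:
  assumes "skeleton \<Pi> A" "skeleton \<Pi> B" "hom A B J" "nodewise_injective A J"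
  shows "card (leq A) \<le> card (leq B)"
proof (rule card_inj_on_le)
  show "inj_on (map_prod (fst J) (fst J)) (leq A)"
    by (rule inj_on_leq [OF assms(1,4)])
  show "map_prod (fst J) (fst J) ` leq A \<subseteq> leq B"
    using hom_leq [OF assms(3)] by auto
  show "finite (leq B)"
    by (rule skeleton_nodes(4) [OF assms(2)])
qed

text \<open>Each message weighs at least 1, so equal totals leave no room for nodes outside the
  image. The total weight thereby counts nodes as well.\<close>

lemma total_weight_hom:
  assumes A: "skeleton \<Pi> A" and B: "skeleton \<Pi> B" and J: "hom A B J"
    and inj: "nodewise_injective A J"
  shows "total_weight A \<le> total_weight B"
    and "total_weight A = total_weight B \<Longrightarrow> fst J ` nodes A = nodes B"
    and "total_weight A = total_weight B \<Longrightarrow> n \<in> nodes A \<Longrightarrow>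
      weight (app (snd J) (node_msg n)) = weight (node_msg n)"
proof -
  have fin: "finite (nodes A)" "finite (nodes B)"
    using A B skeleton_nodes(1) by blast+
  have sub: "fst J ` nodes A \<subseteq> nodes B"
    using hom_node [OF J] by blast
  have le: "weight (node_msg n) \<le> weight (app (snd J) (node_msg n))" for n
    by (rule weight_app [OF hom_mhom [OF J]])
  let ?image = "\<Sum>n\<in>nodes A. weight (app (snd J) (node_msg n))"
  let ?rest = "\<Sum>n\<in>nodes B - fst J ` nodes A. weight (node_msg n)"
  have 1: "total_weight A \<le> ?image"
    unfolding total_weight_def by (intro sum_mono le)
  have "(\<Sum>n\<in>fst J ` nodes A. weight (node_msg n)) = (\<Sum>n\<in>nodes A. weight (node_msg (fst J n)))"
    using inj by (simp add: sum.reindex nodewise_injective_def)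
  also have "\<dots> = ?image"
    by (intro sum.cong) (simp_all add: hom_msg [OF J])
  finally have 2: "total_weight B = ?rest + ?image"
    unfolding total_weight_def 
    using sum.subset_diff [OF sub fin(2), of "\<lambda>n. weight (node_msg n)"] by simp
  show "total_weight A \<le> total_weight B"
    using 1 2 by simp
  show "weight (app (snd J) (node_msg n)) = weight (node_msg n)"
    if "total_weight A = total_weight B" "n \<in> nodes A" for n
  proof -
    have "(\<Sum>n\<in>nodes A. weight (node_msg n)) = ?image"
      using 1 2 that(1) by (simp add: total_weight_def)
    then show ?thesis
      using sum_mono_inv [where f = "\<lambda>n. weight (node_msg n)" and I = "nodes A"
          and g = "\<lambda>n. weight (app (snd J) (node_msg n))" and i = n] le that(2) fin(1) by simp
  qed
  show "fst J ` nodes A = nodes B" if "total_weight A = total_weight B"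
  proof -
    have "?rest = 0"
      using 1 2 that by simp
    then have "\<forall>n\<in>nodes B - fst J ` nodes A. weight (node_msg n) = 0"
      using fin by simp
    then have "nodes B - fst J ` nodes A = {}"
      by (metis all_not_in_conv not_one_le_zero One_nat_def weight_ge_Suc0)
    then show ?thesis
      using sub by blast
  qed
qed

text \<open>From \<open>A\<close> to \<open>B\<close> each component of the measure can only grow
  once the earlier ones agree, so here all are equal. Each equality supplies a part of the inverse:
  orders and weights give surjectivity on the order and on nodes, closures give injectivity on
  parameters, and the counts of atoms give surjectivity on \<open>non\<close> and
  \<open>uniq\<close>.\<close>

lemma hom_inverse_if_not_more_general:
  assumes A: "skeleton \<Pi> A" and B: "skeleton \<Pi> B" and J: "hom A B J"
    and inj: "nodewise_injective A J" and trimmed: "trimmed A" "trimmed B"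
    and min: "(A, B) \<notin> generality"
  obtains J' where "hom B A J'" "nodewise_injective B J'" "hom_eq A (hom_comp J' J) hom_ident"
proof -
  note fin = skeleton_nodes(1) [OF A] skeleton_nodes(1) [OF B]
  have "card (leq A) + total_weight A = card (leq B) + total_weight B"
    using min card_leq_le [OF A B J inj] total_weight_hom(1) [OF A B J inj]
    by (auto simp: generality_def)
  then have leq: "card (leq A) = card (leq B)" and wt: "total_weight A = total_weight B"
    using card_leq_le [OF A B J inj] total_weight_hom(1) [OF A B J inj] by simp_all
  note weight = total_weight_hom(3) [OF A B J inj wt] and nodes = total_weight_hom(2) [OF A B J inj wt]
  have leq_image: "map_prod (fst J) (fst J) ` leq A = leq B"
  proof (rule card_subset_eq)
    show "map_prod (fst J) (fst J) ` leq A \<subseteq> leq B"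
      using hom_leq [OF J] by auto
    show "card (map_prod (fst J) (fst J) ` leq A) = card (leq B)"
      using inj_on_leq [OF A inj] leq by (simp add: card_image)
  qed (rule skeleton_nodes(4) [OF B])
  have closure: "total_closure B = app (snd J) ` total_closure A"
    unfolding total_closure_def nodes [symmetric]
    using closure_app [OF hom_mhom [OF J] weight] hom_msg [OF J] by (simp add: image_UN)
  have "card (total_closure B) \<le> card (total_closure A)"
    unfolding closure by (intro card_image_le card_total_closure fin)
  \<comment> \<open>The bound of the closure by the weight excludes truncated subtraction, so equal
    differences mean equal cardinalities.\<close>
  then have card: "card (total_closure B) = card (total_closure A)"
    using min leq wt card_total_closure [OF fin(1)] card_total_closure [OF fin(2)]
    by (auto simp: generality_def)
  then have inj_closure: "inj_on (app (snd J)) (total_closure A)"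
    using card_total_closure(1) [OF fin(1)] unfolding closure by (intro eq_card_imp_inj_on) simp_all
  have "inj_on (app (snd J)) (\<Union>t\<in>node_msg ` nodes A. closure t)"
    using inj_closure by (simp add: total_closure_def)
  then obtain \<beta> where \<beta>: "mhom \<beta>" "\<And>t. t \<in> node_msg ` nodes A \<Longrightarrow> app \<beta> (app (snd J) t) = t"
    using mhom_inverse [OF hom_mhom [OF J], of "node_msg ` nodes A"] weight by blast
  have "occurring A \<subseteq> total_closure A"
    using params_subset_closure by (fastforce simp: occurring_def total_closure_def)
  then have "inj_on (app (snd J)) (Atm ` (non A \<union> uniq A))"
    using inj_closure trimmed(1) unfolding trimmed_def by (meson inj_on_subset)
  then have inj_atoms: "inj_on (fst (snd J)) (non A \<union> uniq A)"
    using inj_onD by (fastforce simp: inj_on_def)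
  have "card (non B) + card (uniq B) \<le> card (non A) + card (uniq A)"
    using min leq wt card by (auto simp: generality_def)
  moreover have "card (fst (snd J) ` non A) = card (non A)" "card (fst (snd J) ` uniq A) = card (uniq A)"
    using inj_atoms by (auto intro!: card_image simp: inj_on_Un)
  moreover have sub: "fst (snd J) ` non A \<subseteq> non B" "fst (snd J) ` uniq A \<subseteq> uniq B"
    using hom_non [OF J] hom_uniq [OF J] by auto
  note finB = finite_trimmed [OF B trimmed(2)]
  moreover have "card (fst (snd J) ` non A) \<le> card (non B)" "card (fst (snd J) ` uniq A) \<le> card (uniq B)"
    using card_mono [OF finB(1) sub(1)] card_mono [OF finB(2) sub(2)] by blast+
  ultimately have atoms: "fst (snd J) ` non A = non B" "fst (snd J) ` uniq A = uniq B"
    using card_subset_eq [OF finB(1) sub(1)] card_subset_eq [OF finB(2) sub(2)] by linarith+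
  have "bij_betw (fst J) (nodes A) (nodes B)"
    using inj nodes by (simp add: bij_betw_def nodewise_injective_def)
  then show thesis
    by (rule hom_inverse [OF A B J trimmed(1) _ _ _ _ \<beta>(1) \<beta>(2)])
      (use leq_image atoms that in auto)
qed

text \<open>
  The retraction \<open>r\<close> is needed because \<open>A\<close> may declare atoms uncompromised or unique that occur
  in no message of \<open>A\<close>, on which homomorphisms that are identified may differ.
\<close>

lemma shape_below:
  assumes A: "skeleton \<Pi> A" and r: "hom A (trim A) r" "hom_eq A r hom_ident"
    and C: "realized \<Pi> C" and K: "hom A C K"
  obtains B H J where "shape \<Pi> A B H" "hom B C J" "hom_eq A K (hom_comp J H)"
proof -
  have skel: "skeleton \<Pi> B" if "realized \<Pi> B" for B
    using that by (simp add: realized_def)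
  have retract: "hom A (trim B) (hom_comp H r) \<and> hom_eq A H (hom_comp H r)" if "hom A B H" for B H
  proof
    show "hom A (trim B) (hom_comp H r)"
      by (rule hom_hom_comp [OF A r(1) hom_trim [OF that]])
    show "hom_eq A H (hom_comp H r)"
      using hom_eq_comp_left [OF hom_eq_sym [OF r(2)], of H]
      by (simp add: hom_eq_iff)
  qed
  define S where "S = {(B, H). hom A B H \<and> realized \<Pi> B \<and> trimmed B \<and> le_n A B H C K}"
  \<comment> \<open>The set \<open>S\<close> is not empty: up to \<open>hom_eq\<close>,
    \<open>K\<close> passes through \<open>trim C\<close>, with the identity as the nodewise
    injective part.\<close>
  have "le_n A (trim C) (hom_comp K r) C K"
    unfolding le_n_def
    using retract [OF K] hom_of_trim [of C]
    by (intro exI [of _ hom_ident]) (simp add: nodewise_injective_def)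
  then have "(trim C, hom_comp K r) \<in> S"
    using retract [OF K] realized_trim [OF C] trimmed_trim by (simp add: S_def)
  moreover have "wf (inv_image generality fst)"
    by (simp add: generality_def)
  ultimately obtain BH where BH: "BH \<in> S" "\<And>y. (y, BH) \<in> inv_image generality fst \<Longrightarrow> y \<notin> S"
    by (metis wfE_min)
  obtain B H where "BH = (B, H)"
    by (cases BH)
  then have B: "realized \<Pi> B" "trimmed B" and H: "hom A B H" and le: "le_n A B H C K"
    and min: "\<And>B1 H1. (B1, H1) \<in> S \<Longrightarrow> (B1, B) \<notin> generality"
    using BH by (auto simp: S_def)
  obtain J where J: "hom B C J" "nodewise_injective B J" "hom_eq A K (hom_comp J H)"
    using le by (auto simp: le_n_def)
  \<comment> \<open>The competitor \<open>B1\<close> may be untrimmed and hence outside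
    \<open>S\<close>, but \<open>trim B1\<close> with \<open>hom_comp H1 r\<close> is inside.
    Minimality makes \<open>L\<close> invertible, and its inverse leads from \<open>B\<close> back
    to \<open>B1\<close>.\<close>
  have "le_n A B H B1 H1" if H1: "hom A B1 H1" and B1: "realized \<Pi> B1" and le1: "le_n A B1 H1 B H" for B1 H1
  proof -
    obtain L where L: "hom B1 B L" "nodewise_injective B1 L" "hom_eq A H (hom_comp L H1)"
      using le1 by (auto simp: le_n_def)
    have L': "hom (trim B1) B L" "nodewise_injective (trim B1) L"
      using hom_hom_comp [OF skeleton_trim [OF skel [OF B1]] hom_of_trim L(1)] L(2)
      by (simp_all add: nodewise_injective_def)
    have "hom_eq A K (hom_comp J (hom_comp L H1))"
      using J(3) L(3) hom_eq_comp_left hom_eq_trans by blast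
    also have "hom_comp J (hom_comp L H1) = hom_comp (hom_comp J L) H1"
      by (rule hom_comp_assoc)
    finally have "hom_eq A K (hom_comp (hom_comp J L) (hom_comp H1 r))"
      using retract [OF H1] hom_eq_comp_left hom_eq_trans by blast
    moreover have "hom (trim B1) C (hom_comp J L)"
      by (rule hom_hom_comp [OF skeleton_trim [OF skel [OF B1]] L'(1) J(1)])
    moreover have "nodewise_injective (trim B1) (hom_comp J L)"
      using J(2) L(2) hom_node [OF L(1)] unfolding nodewise_injective_def
      by (simp add: inj_on_def)
    ultimately have "le_n A (trim B1) (hom_comp H1 r) C K"
      unfolding le_n_def by blast
    then have "(trim B1, hom_comp H1 r) \<in> S"
      using retract [OF H1] realized_trim [OF B1] trimmed_trim by (simp add: S_def)
    from min [OF this] obtain L'' where L'': "hom B (trim B1) L''" "nodewise_injective B L''"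
      "hom_eq (trim B1) (hom_comp L'' L) hom_ident"
      using hom_inverse_if_not_more_general
        [OF skeleton_trim [OF skel [OF B1]] skel [OF B(1)] L' trimmed_trim B(2)] by blast
    have "hom_eq A (hom_comp (hom_comp L'' L) H1) (hom_comp hom_ident H1)"
      using L''(3) by (intro hom_eq_comp_right [OF H1]) (simp add: hom_eq_iff)
    then have "hom_eq A H1 (hom_comp L'' (hom_comp L H1))"
      by (simp add: hom_comp_assoc hom_eq_sym)
    then have "hom_eq A H1 (hom_comp L'' H)"
      using hom_eq_comp_left [OF L(3)] hom_eq_sym hom_eq_trans by blast
    then show ?thesis
      using hom_untrim [OF L''(1)] L''(2) unfolding le_n_def by blast
  qed
  then have "shape \<Pi> A B H"
    using H B(1) by (simp add: shape_def)
  then show thesis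
    using J that by blast
qed

section \<open>Satisfaction\<close>

lemma lift_op_Some:
  "lift_op f x = Some v \<longleftrightarrow> (\<exists>a b. x = Some (MsgV (Atm a)) \<and> f a = Some b \<and> v = MsgV (Atm b))"
  by (cases "(f, x)" rule: lift_op.cases) auto

text \<open>Definedness passes in one direction only: a key operator has no value at an
  indeterminate, but may acquire one when an atom is substituted for it.\<close>

lemma eval_kterm_hom:
  assumes "mhom \<alpha>" and h: "\<And>t. h (MsgV t) = MsgV (app \<alpha> t)"
    and "\<tau> (kterm_var k) = map_option h (\<sigma> (kterm_var k))" "eval_kterm \<sigma> k = Some v"
  shows "eval_kterm \<tau> k = Some (h v)"
  using assms(3,4)
proof (induction k arbitrary: v)
  case (SkT k)
  then show ?case using assms(1) by (auto simp: lift_op_Some h atom_hom_sk mhom_def)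
next
  case (PkT k)
  then show ?case using assms(1) by (auto simp: lift_op_Some h atom_hom_pk mhom_def)
next
  case (InvT k)
  then show ?case using assms(1) by (auto simp: lift_op_Some h atom_hom_inv mhom_def)
qed auto

text \<open>The operators on atoms are injective. A claim may mention a name only through
  \<open>SkT (Var v)\<close>, and the name itself may then occur in no message; agreement on the key
  still gives agreement on the name.\<close>

lemma eval_kterm_agree:
  assumes \<alpha>: "mhom \<alpha>" and \<beta>: "mhom \<beta>"
    and "eval_kterm \<sigma> k = Some (MsgV t)" "app \<alpha> t = app \<beta> t"
  shows "\<exists>u. \<sigma> (kterm_var k) = Some (MsgV u) \<and> app \<alpha> u = app \<beta> u"
  using assms(3,4)
proof (induction k arbitrary: t)
  case (SkT k)
  then obtain a b where k: "eval_kterm \<sigma> k = Some (MsgV (Atm a))" "sk_atom a = Some b" "t = Atm b"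
    by (auto simp: lift_op_Some)
  have "sk_atom (fst \<alpha> a) = Some (fst \<alpha> b)" "sk_atom (fst \<beta> a) = Some (fst \<alpha> b)"
    using k SkT.prems(2) \<alpha> \<beta> by (simp_all add: mhom_def atom_hom_sk)
  then show ?case using SkT.IH [OF k(1)] sk_atom_inj by fastforce
next
  case (PkT k)
  then obtain a b where k: "eval_kterm \<sigma> k = Some (MsgV (Atm a))" "pk_atom a = Some b" "t = Atm b"
    by (auto simp: lift_op_Some)
  have "pk_atom (fst \<alpha> a) = Some (fst \<alpha> b)" "pk_atom (fst \<beta> a) = Some (fst \<alpha> b)"
    using k PkT.prems(2) \<alpha> \<beta> by (simp_all add: mhom_def atom_hom_pk)
  then show ?case using PkT.IH [OF k(1)] pk_atom_inj by fastforce
next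
  case (InvT k)
  then obtain a b where k: "eval_kterm \<sigma> k = Some (MsgV (Atm a))" "inv_atom a = Some b" "t = Atm b"
    by (auto simp: lift_op_Some)
  have "inv_atom (fst \<alpha> a) = Some (fst \<alpha> b)" "inv_atom (fst \<beta> a) = Some (fst \<alpha> b)"
    using k InvT.prems(2) \<alpha> \<beta> by (simp_all add: mhom_def atom_hom_inv)
  then show ?case using InvT.IH [OF k(1)] inv_atom_inj by fastforce
qed auto

text \<open>Nodes are counted from 1 and trace positions from 0, hence \<open>Suc i\<close>.\<close>

lemma instance_event:
  assumes "instance_under \<alpha> \<rho> j (s, j)" "i < j"
  shows "event (s, Suc i) = (fst (\<rho> ! i), app \<alpha> (snd (\<rho> ! i)))"
proof -
  have "snd s ! i = take j (snd s) ! i"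
    using assms(2) by simp
  also have "\<dots> = app_trace \<alpha> (take j \<rho>) ! i"
    using assms(1) by (simp add: instance_under_def)
  also have "\<dots> = (fst (\<rho> ! i), app \<alpha> (snd (\<rho> ! i)))"
    using assms by (simp add: instance_under_def app_trace_def split_beta)
  finally show ?thesis
    by (simp add: event_def)
qed

text \<open>The strand clause of \<open>hom\<close> moves the whole initial segment to one strand,
  so the instantiation can be composed with \<open>snd H\<close> at every position of the role
  prefix.\<close>

lemma instance_hom:
  assumes A: "skeleton \<Pi> A" and B: "skeleton \<Pi> B" and H: "hom A B H"
    and n: "n \<in> nodes A" and inst: "instance_under \<alpha> \<rho> j n"
  shows "instance_under (mhom_comp (snd H) \<alpha>) \<rho> j (fst H n)"
proof -
  obtain s where s: "n = (s, j)"
    using inst by (cases n) (auto simp: instance_under_def)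
  obtain s' where s': "\<And>i. 1 \<le> i \<Longrightarrow> i \<le> j \<Longrightarrow> fst H (s, i) = (s', i)"
    using hom_strand [OF H] n s by blast
  have j: "1 \<le> j"
    using skeleton_is_node [OF A n] s by (simp add: is_node_def)
  then have Hn: "fst H n = (s', j)"
    using s s' by simp
  then have len: "is_node (s', j)" "j \<le> length (snd s')"
    using skeleton_is_node [OF B hom_node [OF H n]] by (auto simp: is_node_def)
  have j\<rho>: "j \<le> length \<rho>"
    using inst by (simp add: instance_under_def)
  have "take j (snd s') = app_trace (mhom_comp (snd H) \<alpha>) (take j \<rho>)"
  proof (rule nth_equalityI)
    show "length (take j (snd s')) = length (app_trace (mhom_comp (snd H) \<alpha>) (take j \<rho>))"
      using len j\<rho> by (simp add: app_trace_def)
    fix i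
    assume "i < length (take j (snd s'))"
    then have i: "i < j"
      by simp
    have m: "(s, Suc i) \<in> nodes A"
      using skeleton_prefix [OF A, of s j "Suc i"] n s i by simp
    have "event (s', Suc i) = (fst (\<rho> ! i), app (snd H) (app \<alpha> (snd (\<rho> ! i))))"
      using instance_event [OF inst [unfolded s] i] hom_msg [OF H m] hom_dir [OF H m] s' [of "Suc i"] i
      by (simp add: node_msg_def node_dir_def prod_eq_iff)
    then show "take j (snd s') ! i = app_trace (mhom_comp (snd H) \<alpha>) (take j \<rho>) ! i"
      using i j\<rho> by (simp add: event_def app_trace_def split_beta)
  qed
  then show ?thesis
    using inst Hn len j\<rho> hom_mhom [OF H] by (simp add: instance_under_def mhom_mhom_comp)
qed

lemma instance_occurring:
  assumes A: "skeleton \<Pi> A" and n: "n \<in> nodes A" and inst: "instance_under \<alpha> \<rho> j n"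
    and p: "p \<in> set (role_params \<rho> j)"
  shows "set (msg_params (app \<alpha> p)) \<subseteq> occurring A"
proof -
  obtain s where s: "n = (s, j)"
    using inst by (cases n) (auto simp: instance_under_def)
  obtain e where e: "e \<in> set (take j \<rho>)" "p \<in> set (msg_params (snd e))"
    using p by (auto simp: role_params_def)
  then obtain i where i: "i < j" "e = \<rho> ! i"
    by (auto simp: in_set_conv_nth)
  have "(s, Suc i) \<in> nodes A"
    using skeleton_prefix [OF A, of s j "Suc i"] n s i by simp
  moreover have "node_msg (s, Suc i) = app \<alpha> (snd e)"
    using instance_event [OF inst [unfolded s] i(1)] i(2) by (simp add: node_msg_def)
  ultimately show ?thesis
    using msg_params_app_param [OF e(2), of \<alpha>] unfolding occurring_def by force
qed

text \<open>Except in an equation, the node arguments of a true atomic formula lie in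
  \<open>nodes A\<close>. On other nodes \<open>h\<close> is arbitrary, and equations survive
  because \<open>h\<close> is a function. This freedom lets nodes outside a skeleton stand for any
  values.\<close>

lemma sat_atomic_hom:
  assumes A: "skeleton \<Pi> A" and B: "skeleton \<Pi> B" and H: "hom A B H"
    and h: "\<And>t. h (MsgV t) = MsgV (app (snd H) t)" "\<And>n. n \<in> nodes A \<Longrightarrow> h (NodeV n) = NodeV (fst H n)"
    and \<tau>: "\<And>x. x \<in> kterm_var ` args a \<Longrightarrow> \<tau> x = map_option h (\<sigma> x)"
    and sat: "sat_atomic A \<sigma> a"
  shows "sat_atomic B \<tau> a"
proof -
  have eval: "eval_kterm \<tau> t = Some (h v)" if "t \<in> args a" "eval_kterm \<sigma> t = Some v" for t v
    using eval_kterm_hom [OF hom_mhom [OF H] h(1)] \<tau> that by blast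
  show ?thesis
  proof (cases a)
    case (Eq t u)
    then show ?thesis
      using sat eval [of t] eval [of u] by (cases "eval_kterm \<sigma> u") auto
  next
    case (Non t)
    then show ?thesis using eval [of t] sat hom_non [OF H] by (auto simp: h)
  next
    case (Unq t)
    then show ?thesis using eval [of t] sat hom_uniq [OF H] by (auto simp: h)
  next
    case (Col t u)
    have chain: "succ\<^sup>*\<^sup>* (fst H m) (fst H n)" if "succ\<^sup>*\<^sup>* m n" "n \<in> nodes A" for m n
      using that succ_trancl_hom [OF A B H] by (metis rtranclpD rtranclp.rtrancl_refl tranclp_into_rtranclp)
    obtain m n where "m \<in> nodes A" "n \<in> nodes A" "eval_kterm \<sigma> t = Some (NodeV m)"
      "eval_kterm \<sigma> u = Some (NodeV n)" "succ\<^sup>*\<^sup>* m n \<or> succ\<^sup>*\<^sup>* n m"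
      using sat [unfolded Col sat_atomic.simps] by blast
    moreover from this have "eval_kterm \<tau> t = Some (NodeV (fst H m))"
      "eval_kterm \<tau> u = Some (NodeV (fst H n))"
      using eval Col h by simp_all
    ultimately show ?thesis
      using chain hom_node [OF H] unfolding Col sat_atomic.simps by blast
  next
    case (Preceq t u)
    then obtain m n where mn: "eval_kterm \<sigma> t = Some (NodeV m)" "eval_kterm \<sigma> u = Some (NodeV n)"
      "(m, n) \<in> leq A"
      using sat [unfolded Preceq sat_atomic.simps] by blast
    then have "m \<in> nodes A" "n \<in> nodes A"
      using skeleton_nodes(3) [OF A] by blast+
    then have "eval_kterm \<tau> t = Some (NodeV (fst H m))" "eval_kterm \<tau> u = Some (NodeV (fst H n))"
      using eval Preceq h mn by simp_all
    then show ?thesis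
      using hom_leq [OF H mn(3)] unfolding Preceq sat_atomic.simps by blast
  next
    case (RP \<rho> j m ts)
    then obtain n \<alpha> where n: "n \<in> nodes A" "\<sigma> m = Some (NodeV n)" "instance_under \<alpha> \<rho> j n"
      and ts: "map (eval_kterm \<sigma>) ts = map (\<lambda>p. Some (MsgV (app \<alpha> p))) (role_params \<rho> j)"
      using sat [unfolded RP sat_atomic.simps] by blast
    have m: "\<tau> m = Some (NodeV (fst H n))"
      using eval [of "Var m"] n h RP by simp
    have "map (eval_kterm \<tau>) ts = map (\<lambda>x. map_option h (eval_kterm \<sigma> x)) ts"
    proof (rule map_cong)
      fix t
      assume t: "t \<in> set ts"
      then have "eval_kterm \<sigma> t \<in> set (map (\<lambda>p. Some (MsgV (app \<alpha> p))) (role_params \<rho> j))"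
        using ts by (metis imageI list.set_map)
      then show "eval_kterm \<tau> t = map_option h (eval_kterm \<sigma> t)"
        using eval [of t] t RP by auto
    qed simp
    also have "\<dots> = map (map_option h) (map (eval_kterm \<sigma>) ts)"
      by simp
    also have "\<dots> = map (\<lambda>p. Some (MsgV (app (mhom_comp (snd H) \<alpha>) p))) (role_params \<rho> j)"
      unfolding ts by (simp add: h)
    finally show ?thesis
      using m hom_node [OF H n(1)] instance_hom [OF A B H n(1,3)] unfolding RP sat_atomic.simps by blast
  qed (use sat in auto)
qed

lemma sat_Conj_hom:
  assumes A: "skeleton \<Pi> A" and B: "skeleton \<Pi> B" and H: "hom A B H"
    and h: "\<And>t. h (MsgV t) = MsgV (app (snd H) t)" "\<And>n. n \<in> nodes A \<Longrightarrow> h (NodeV n) = NodeV (fst H n)"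
    and \<tau>: "\<And>x. x \<in> fv (Conj (map Atomic as)) \<Longrightarrow> \<tau> x = map_option h (\<sigma> x)"
    and sat: "sat \<Pi> A \<sigma> (Conj (map Atomic as))"
  shows "sat \<Pi> B \<tau> (Conj (map Atomic as))"
proof -
  have dom: "fv (Conj (map Atomic as)) \<subseteq> dom \<tau>"
  proof
    fix x
    assume x: "x \<in> fv (Conj (map Atomic as))"
    then have "x \<in> dom \<sigma>"
      using sat unfolding sat.simps by blast
    then show "x \<in> dom \<tau>"
      using \<tau> [OF x] by (auto simp: dom_def)
  qed
  have "sat \<Pi> B \<tau> (Atomic a)" if a: "a \<in> set as" for a
  proof -
    have "sat_atomic B \<tau> a"
    proof (rule sat_atomic_hom [OF A B H h])
      show "\<tau> x = map_option h (\<sigma> x)" if "x \<in> kterm_var ` args a" for x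
        using \<tau> that a by auto
      show "sat_atomic A \<sigma> a"
        using sat a by simp
    qed
    then show ?thesis
      using dom a by auto
  qed
  then show ?thesis
    using dom by simp
qed

lemma sat_Disj_hom:
  assumes A: "skeleton \<Pi> A" and B: "skeleton \<Pi> B" and H: "hom A B H"
    and h: "\<And>t. h (MsgV t) = MsgV (app (snd H) t)" "\<And>n. n \<in> nodes A \<Longrightarrow> h (NodeV n) = NodeV (fst H n)"
    and \<psi>: "\<psi> = Disj (map (\<lambda>as. Conj (map Atomic as)) ass)"
    and \<tau>: "\<And>x. x \<in> fv \<psi> \<Longrightarrow> \<tau> x = map_option h (\<sigma> x)"
    and sat: "sat \<Pi> A \<sigma> \<psi>"
  shows "sat \<Pi> B \<tau> \<psi>"
proof -
  have dom: "fv \<psi> \<subseteq> dom \<tau>"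
  proof
    fix x
    assume x: "x \<in> fv \<psi>"
    then have "x \<in> dom \<sigma>"
      using sat unfolding \<psi> sat.simps by blast
    then show "x \<in> dom \<tau>"
      using \<tau> [OF x] by (auto simp: dom_def)
  qed
  obtain as where as: "as \<in> set ass" "sat \<Pi> A \<sigma> (Conj (map Atomic as))"
    using sat unfolding \<psi> by auto
  moreover have "fv (Conj (map Atomic as)) \<subseteq> fv \<psi>"
    using as(1) unfolding \<psi> by auto
  ultimately have "sat \<Pi> B \<tau> (Conj (map Atomic as))"
    using sat_Conj_hom [OF A B H h] \<tau> by blast
  then show ?thesis
    using as(1) dom unfolding \<psi> by auto
qed

text \<open>In \<open>[x \<mapsto> v] ++ \<tau>\<close> the right operand wins, as it must when
  \<open>x\<close> is bound again further inside and the inner quantifier shadows the outer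
  one.\<close>

lemma assignment_Cons:
  "(\<forall>\<tau>. dom \<tau> = set (x # xs) \<and> assignment \<Pi> \<tau> \<longrightarrow> P \<tau>) \<longleftrightarrow>
   (\<forall>v\<in>vals \<Pi>. \<forall>\<tau>. dom \<tau> = set xs \<and> assignment \<Pi> \<tau> \<longrightarrow> P ([x \<mapsto> v] ++ \<tau>))" (is "?L \<longleftrightarrow> ?R")
proof
  assume L: ?L
  show ?R
  proof (intro ballI allI impI)
    fix v \<tau>
    assume v: "v \<in> vals \<Pi>" and \<tau>: "dom \<tau> = set xs \<and> assignment \<Pi> \<tau>"
    have "dom ([x \<mapsto> v] ++ \<tau>) = set (x # xs)"
      using \<tau> by auto
    moreover have "assignment \<Pi> ([x \<mapsto> v] ++ \<tau>)"
      using \<tau> v by (auto simp: assignment_def ran_def map_add_Some_iff split: if_splits)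
    ultimately show "P ([x \<mapsto> v] ++ \<tau>)"
      using L by blast
  qed
next
  assume R: ?R
  show ?L
  proof (intro allI impI)
    fix \<tau>
    assume \<tau>: "dom \<tau> = set (x # xs) \<and> assignment \<Pi> \<tau>"
    then obtain v where v: "\<tau> x = Some v"
      by (metis domD list.set_intros(1))
    then have "v \<in> vals \<Pi>"
      using \<tau> by (auto simp: assignment_def ran_def)
    moreover have "dom (\<tau> |` set xs) = set xs"
      using \<tau> by auto
    moreover have "assignment \<Pi> (\<tau> |` set xs)"
      using \<tau> by (auto simp: assignment_def ran_def restrict_map_def)
    moreover have "[x \<mapsto> v] ++ \<tau> |` set xs = \<tau>"
    proof
      fix y
      show "([x \<mapsto> v] ++ \<tau> |` set xs) y = \<tau> y"
        using \<tau> v by (cases "\<tau> y") (auto simp: map_add_def restrict_map_def domIff)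
    qed
    ultimately show "P \<tau>"
      using R by metis
  qed
qed

lemma sat_foldr_All:
  assumes "fv (foldr All xs f) \<subseteq> dom \<sigma>"
  shows "sat \<Pi> A \<sigma> (foldr All xs f) \<longleftrightarrow>
    (\<forall>\<tau>. dom \<tau> = set xs \<and> assignment \<Pi> \<tau> \<longrightarrow> sat \<Pi> A (\<sigma> ++ \<tau>) f)"
  using assms
proof (induction xs arbitrary: \<sigma>)
  case (Cons x xs)
  have "sat \<Pi> A (\<sigma>(x \<mapsto> v)) (foldr All xs f) \<longleftrightarrow>
      (\<forall>\<tau>. dom \<tau> = set xs \<and> assignment \<Pi> \<tau> \<longrightarrow> sat \<Pi> A (\<sigma> ++ ([x \<mapsto> v] ++ \<tau>)) f)" for v
    using Cons.prems by (subst Cons.IH) (auto simp: map_add_assoc)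
  then show ?case
    unfolding assignment_Cons using Cons.prems by simp
qed (auto simp: assignment_def)

lemma sat_foldr_Ex:
  assumes "fv (foldr Ex ys f) \<subseteq> dom \<sigma>"
  shows "sat \<Pi> A \<sigma> (foldr Ex ys f) \<longleftrightarrow>
    (\<exists>\<tau>. dom \<tau> = set ys \<and> assignment \<Pi> \<tau> \<and> sat \<Pi> A (\<sigma> ++ \<tau>) f)"
  using assms
proof (induction ys arbitrary: \<sigma>)
  case (Cons y ys)
  have "sat \<Pi> A (\<sigma>(y \<mapsto> v)) (foldr Ex ys f) \<longleftrightarrow>
      (\<exists>\<tau>. dom \<tau> = set ys \<and> assignment \<Pi> \<tau> \<and> sat \<Pi> A (\<sigma> ++ ([y \<mapsto> v] ++ \<tau>)) f)" for v
    using Cons.prems by (subst Cons.IH) (auto simp: map_add_assoc)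
  then show ?case
    using assignment_Cons [of y ys \<Pi> "\<lambda>\<tau>. \<not> sat \<Pi> A (\<sigma> ++ \<tau>) f"] Cons.prems by simp blast
qed (auto simp: assignment_def)

lemma fv_foldr: "fv (foldr All xs f) = fv f - set xs" "fv (foldr Ex xs f) = fv f - set xs"
  by (induction xs) auto

section \<open>Characteristic skeletons\<close>

text \<open>Every argument in a claim also stands in a role predicate. There it denotes the node or
  the value of a role parameter, and that value appears along the instance.\<close>

lemma claim_arg:
  assumes A: "skeleton \<Pi> A" and sat: "sat \<Pi> A \<sigma> (Conj (map Atomic as))"
    and claim: "security_claim \<Pi> (Conj (map Atomic as))" and a: "a \<in> set as" and t: "t \<in> args a"
  shows "(\<exists>m. \<exists>n\<in>nodes A. t = Var m \<and> \<sigma> m = Some (NodeV n)) \<or>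
    (\<exists>u. eval_kterm \<sigma> t = Some (MsgV u) \<and> set (msg_params u) \<subseteq> occurring A)"
proof -
  have "\<exists>b\<in>set as. is_RP b \<and> t \<in> args b"
  proof (cases "is_RP a")
    case False
    obtain bs where bs: "map Atomic as = map Atomic bs"
      "\<forall>a\<in>set bs. \<not> is_RP a \<longrightarrow> args a \<subseteq> \<Union> (args ` {b \<in> set bs. is_RP b})"
      using claim unfolding security_claim_def by auto
    have "as = bs"
      using bs(1) by (simp add: inj_map_eq_map inj_def)
    then have "args a \<subseteq> \<Union> (args ` {b \<in> set as. is_RP b})"
      using bs(2) a False by blast
    then show ?thesis using t by blast
  qed (use a t in blast)
  then obtain \<rho> j m ts where b: "RP \<rho> j m ts \<in> set as" "t \<in> args (RP \<rho> j m ts)"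
    by (metis is_RP.elims(2))
  then have "sat_atomic A \<sigma> (RP \<rho> j m ts)"
    using sat by auto
  then obtain n \<alpha> where n: "n \<in> nodes A" "\<sigma> m = Some (NodeV n)" "instance_under \<alpha> \<rho> j n"
    and ts: "map (eval_kterm \<sigma>) ts = map (\<lambda>p. Some (MsgV (app \<alpha> p))) (role_params \<rho> j)"
    unfolding sat_atomic.simps by blast
  show ?thesis
  proof (cases "t = Var m")
    case False
    then have "eval_kterm \<sigma> t \<in> set (map (\<lambda>p. Some (MsgV (app \<alpha> p))) (role_params \<rho> j))"
      using b(2) unfolding ts [symmetric] by auto
    then show ?thesis
      using instance_occurring [OF A n(1,3)] by auto
  qed (use n in blast)
qed

lemma claim_value:
  assumes A: "skeleton \<Pi> A" and sat: "sat \<Pi> A \<sigma> \<phi>" and claim: "security_claim \<Pi> \<phi>"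
    and x: "x \<in> fv \<phi>" and H: "mhom (snd H)" "mhom (snd H')" "hom_eq A H H'"
  shows "(\<exists>n\<in>nodes A. \<sigma> x = Some (NodeV n)) \<or>
    (\<exists>u. \<sigma> x = Some (MsgV u) \<and> app (snd H) u = app (snd H') u)"
proof -
  obtain as where as: "\<phi> = Conj (map Atomic as)"
    using claim by (auto simp: security_claim_def)
  then obtain a t where t: "a \<in> set as" "t \<in> args a" "x = kterm_var t"
    using x by auto
  from claim_arg [OF A sat [unfolded as] claim [unfolded as] t(1,2)] show ?thesis
  proof (elim disjE exE conjE bexE)
    fix u
    assume u: "eval_kterm \<sigma> t = Some (MsgV u)" "set (msg_params u) \<subseteq> occurring A"
    have "app (snd H) u = app (snd H') u"
      using u(2) hom_eq_occurring [OF H(3)] by (intro app_eq_iff_params [THEN iffD2]) blast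
    then show ?thesis
      using eval_kterm_agree [OF H(1,2) u(1)] t(3) by blast
  qed (use t in auto)
qed

text \<open>\<open>hom_eq\<close> does not determine such a composition in general, since an
  assignment may use parameters that occur nowhere. Values of claim variables do not have this
  freedom.\<close>

lemma claim_hom_asg_eq:
  assumes "skeleton \<Pi> A" "sat \<Pi> A \<sigma> \<phi>" "security_claim \<Pi> \<phi>" "x \<in> fv \<phi>"
    and "mhom (snd H)" "mhom (snd H')" "hom_eq A H H'"
  shows "hom_asg A H \<sigma> x = hom_asg A H' \<sigma> x"
  using claim_value [OF assms] hom_eq_node [OF assms(7)] by (auto simp: hom_asg_def)

lemma claim_hom_asg:
  assumes "skeleton \<Pi> A" "sat \<Pi> A \<sigma> \<phi>" "security_claim \<Pi> \<phi>" "x \<in> fv \<phi>" "mhom (snd H)"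
    and h: "\<And>t. h (MsgV t) = MsgV (app (snd H) t)" "\<And>n. n \<in> nodes A \<Longrightarrow> h (NodeV n) = NodeV (fst H n)"
  shows "hom_asg A H \<sigma> x = map_option h (\<sigma> x)" "x \<in> dom (hom_asg A H \<sigma>)"
  using claim_value [OF assms(1-5) assms(5)] h by (auto simp: hom_asg_def hom_eq_iff)

lemma hom_asg_comp:
  assumes "hom A B H" and h: "\<And>t. h (MsgV t) = MsgV (app (snd J) t)"
    "\<And>n. n \<in> nodes B \<Longrightarrow> h (NodeV n) = NodeV (fst J n)"
  shows "hom_asg A (hom_comp J H) \<sigma> x = map_option h (hom_asg A H \<sigma> x)"
proof (cases "\<sigma> x")
  case (Some v)
  then show ?thesis
    using hom_node [OF assms(1)] h by (cases v) (simp_all add: hom_asg_def)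
qed (simp add: hom_asg_def)

lemma hom_asg_dom: "dom (hom_asg A H \<sigma>) = dom (hom_asg A H' \<sigma>)"
proof -
  have "hom_asg A H \<sigma> x = None \<longleftrightarrow> hom_asg A H' \<sigma> x = None" for x
  proof (cases "\<sigma> x")
    case (Some v)
    then show ?thesis by (cases v) (simp_all add: hom_asg_def)
  qed (simp add: hom_asg_def)
  then show ?thesis by (auto simp: dom_def)
qed

lemma sat_fv_dom: "sat \<Pi> A \<sigma> f \<Longrightarrow> fv f \<subseteq> dom \<sigma>"
  by (cases f) simp_all

text \<open>An atom that a claim declares non-originating or unique is an argument of a role
  predicate, so it occurs and is not discarded.\<close>

lemma sat_trim:
  assumes A: "skeleton \<Pi> A" and sat: "sat \<Pi> A \<sigma> \<phi>" and claim: "security_claim \<Pi> \<phi>"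
  shows "sat \<Pi> (trim A) \<sigma> \<phi>"
proof -
  obtain as where as: "\<phi> = Conj (map Atomic as)"
    using claim by (auto simp: security_claim_def)
  have "sat_atomic (trim A) \<sigma> a" if a: "a \<in> set as" for a
  proof -
    have sat_a: "sat_atomic A \<sigma> a"
      using sat a unfolding as by simp
    have occ: "Atm b \<in> occurring A" if "t \<in> args a" "eval_kterm \<sigma> t = Some (MsgV (Atm b))" for t b
      using claim_arg [OF A sat [unfolded as] claim [unfolded as] a that(1)] that(2) by auto
    show ?thesis
    proof (cases a)
      case (Eq t u)
      then show ?thesis using sat_a by (cases "eval_kterm \<sigma> u") auto
    next
      case (Non t)
      then show ?thesis using occ sat_a by auto
    next
      case (Unq t)
      then show ?thesis using occ sat_a by auto
    qed (use sat_a in simp_all)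
  qed
  then show ?thesis
    using sat_fv_dom [OF sat] sat unfolding as by auto
qed

text \<open>The universal property applied to the pair itself gives one homomorphism whose
  composition with \<sigma> has this domain, and the domain is the same for all
  homomorphisms.\<close>

lemma characteristic_dom:
  assumes char: "characteristic \<Pi> \<phi> A \<sigma>"
  shows "dom (hom_asg A H \<sigma>) = fv \<phi>"
proof -
  obtain K where "\<sigma> |` fv \<phi> = hom_asg A K \<sigma>"
    using char unfolding characteristic_def by blast
  moreover have "fv \<phi> \<subseteq> dom \<sigma>"
    using char sat_fv_dom unfolding characteristic_def by blast
  ultimately have "dom (hom_asg A K \<sigma>) = fv \<phi>"
    by (metis dom_restrict inf.absorb2)
  then show ?thesis
    using hom_asg_dom by metis
qed

text \<open>\<open>trim A\<close> still satisfies \<phi>, which yields \<open>r\<close>. Read as an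
  endomorphism of \<open>A\<close>, it induces the same assignment as the identity, so uniqueness
  identifies the two.\<close>

lemma characteristic_retraction:
  assumes claim: "security_claim \<Pi> \<phi>" and char: "characteristic \<Pi> \<phi> A \<sigma>"
  obtains r where "hom A (trim A) r" "hom_eq A r hom_ident"
proof -
  have A: "skeleton \<Pi> A" and \<sigma>: "assignment \<Pi> \<sigma>" and sat: "sat \<Pi> A \<sigma> \<phi>"
    using char by (simp_all add: characteristic_def)
  obtain r where r: "hom A (trim A) r" "\<sigma> |` fv \<phi> = hom_asg A r \<sigma>"
    using char skeleton_trim [OF A] sat_trim [OF A sat claim] \<sigma> unfolding characteristic_def by blast
  obtain H where H: "\<And>H'. hom A A H' \<Longrightarrow> \<sigma> |` fv \<phi> = hom_asg A H' \<sigma> \<Longrightarrow> hom_eq A H H'"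
    using char A sat \<sigma> unfolding characteristic_def by blast
  have "\<sigma> |` fv \<phi> = hom_asg A hom_ident \<sigma>"
  proof
    fix x
    show "(\<sigma> |` fv \<phi>) x = hom_asg A hom_ident \<sigma> x"
    proof (cases "x \<in> fv \<phi>")
      case True
      then show ?thesis
        using claim_hom_asg(1) [OF A sat claim True, of hom_ident id] by (simp add: option.map_id)
    next
      case False
      then have "x \<notin> dom (hom_asg A hom_ident \<sigma>)"
        using characteristic_dom [OF char] by simp
      then show ?thesis
        using False by (simp add: domIff)
    qed
  qed
  then have "hom_eq A H hom_ident"
    using H hom_ident by blast
  moreover have "hom_eq A H r"
    using H hom_untrim r by blast
  ultimately show thesis
    using that r(1) hom_eq_sym hom_eq_trans by blast
qed

lemma hom_val_total:
  obtains h where "\<And>t. h (MsgV t) = MsgV (app (snd H) t)" "\<And>n. h (NodeV n) = NodeV (fst H n)"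
  by (rule that [of "\<lambda>v. case v of MsgV t \<Rightarrow> MsgV (app (snd H) t) | NodeV n \<Rightarrow> NodeV (fst H n)"]) simp_all

lemma sat_claim_hom_asg:
  assumes A: "skeleton \<Pi> A" and B: "skeleton \<Pi> B" and H: "hom A B H"
    and claim: "security_claim \<Pi> \<phi>" and sat: "sat \<Pi> A \<sigma> \<phi>" and \<tau>: "hom_asg A H \<sigma> \<subseteq>\<^sub>m \<tau>"
  shows "sat \<Pi> B \<tau> \<phi>"
proof -
  obtain as where as: "\<phi> = Conj (map Atomic as)"
    using claim by (auto simp: security_claim_def)
  obtain h where h: "\<And>t. h (MsgV t) = MsgV (app (snd H) t)" "\<And>n. h (NodeV n) = NodeV (fst H n)"
    using hom_val_total [of H] by blast
  have "\<tau> x = map_option h (\<sigma> x)" if "x \<in> fv \<phi>" for x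
    using claim_hom_asg [OF A sat claim that hom_mhom [OF H] h] \<tau> unfolding map_le_def by metis
  then show ?thesis
    using sat_Conj_hom [OF A B H h] sat unfolding as by blast
qed

section \<open>Nodes of the protocol outside a given skeleton\<close>

definition fresh_node :: "nat \<Rightarrow> var \<Rightarrow> 't node" where
  "fresh_node N x = ((N + x, listener), 1)"

text \<open>The listener is a role of every protocol and strand identities are arbitrary, so
  listener strands supply distinct nodes for all variables at once.\<close>

lemma fresh_node_nodes_of: "fresh_node N x \<in> nodes_of \<Pi>"
proof -
  have "instance_under (id, Ind) listener 1 (fresh_node N x)"
    by (simp add: instance_under_def fresh_node_def is_node_def app_trace_def listener_def)
  then show ?thesis
    by (auto simp: nodes_of_def roles_def)
qed

lemma ex_fresh_node:
  assumes "skeleton \<Pi> B"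
  obtains N where "\<And>x. fresh_node N x \<notin> nodes B"
proof -
  have "finite ((\<lambda>n. fst (fst n)) ` nodes B)"
    using skeleton_nodes(1) [OF assms] by simp
  then obtain N where "\<forall>i\<in>(\<lambda>n. fst (fst n)) ` nodes B. i < N"
    unfolding finite_nat_set_iff_bounded by blast
  then have "fresh_node N x \<notin> nodes B" for x
    by (force simp: fresh_node_def)
  then show thesis
    by (rule that)
qed

theorem theorem6p1:
  fixes \<Pi> :: "'t trace set"
    and \<phi> \<psi> :: "'t form"
    and xs ys :: "var list"
    and A :: "'t skeleton"
    and \<sigma>' :: "'t asg"
  assumes "protocol \<Pi>"
    and "security_goal \<Pi> xs \<phi> ys \<psi>"
    and "satisfiable \<Pi> \<phi>"
    and "characteristic \<Pi> \<phi> A \<sigma>'"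
  shows "achieves \<Pi> (goal_form xs \<phi> ys \<psi>) \<longleftrightarrow>
    (\<forall>B H. shape \<Pi> A B H \<longrightarrow>
      (\<forall>\<tau>. assignment \<Pi> \<tau> \<and> extends_on xs \<tau> (hom_asg A H \<sigma>') \<longrightarrow>
        (\<exists>\<sigma>. assignment \<Pi> \<sigma> \<and> \<tau> \<subseteq>\<^sub>m \<sigma> \<and> sat \<Pi> B \<sigma> \<psi>)))"
proof -
  have claim: "security_claim \<Pi> \<phi>" and disjoint: "set xs \<inter> set ys = {}"
    and closed: "fv (goal_form xs \<phi> ys \<psi>) = {}"
    using assms(2) by (simp_all add: security_goal_def)
  obtain ass where \<psi>: "\<psi> = Disj (map (\<lambda>as. Conj (map Atomic as)) ass)"
    using assms(2) by (auto simp: security_goal_def)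
  have fv_\<phi>: "fv \<phi> \<subseteq> set xs" and fv_\<psi>: "fv \<psi> \<subseteq> set xs \<union> set ys"
    using closed by (auto simp: goal_form_def fv_foldr)
  have A: "skeleton \<Pi> A" and sat_A: "sat \<Pi> A \<sigma>' \<phi>"
    using assms(4) by (simp_all add: characteristic_def)
  \<comment> \<open>Each prefix becomes a quantification over assignments whose domain is exactly
    the prefix, the form that \<open>extends_on\<close> also has.\<close>
  have sat_goal: "sat \<Pi> B \<sigma> (goal_form xs \<phi> ys \<psi>) \<longleftrightarrow>
      (\<forall>\<tau>. dom \<tau> = set xs \<and> assignment \<Pi> \<tau> \<longrightarrow> sat \<Pi> B (\<sigma> ++ \<tau>) \<phi> \<longrightarrow>
        (\<exists>\<tau>'. dom \<tau>' = set ys \<and> assignment \<Pi> \<tau>' \<and> sat \<Pi> B (\<sigma> ++ \<tau> ++ \<tau>') \<psi>))" for B \<sigma>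
  proof -
    have "sat \<Pi> B (\<sigma> ++ \<tau>) (Imp \<phi> (foldr Ex ys \<psi>)) \<longleftrightarrow> (sat \<Pi> B (\<sigma> ++ \<tau>) \<phi> \<longrightarrow>
        (\<exists>\<tau>'. dom \<tau>' = set ys \<and> assignment \<Pi> \<tau>' \<and> sat \<Pi> B (\<sigma> ++ \<tau> ++ \<tau>') \<psi>))"
      if \<tau>: "dom \<tau> = set xs" for \<tau>
    proof -
      have "fv (foldr Ex ys \<psi>) \<subseteq> dom (\<sigma> ++ \<tau>)" "fv \<phi> \<subseteq> dom (\<sigma> ++ \<tau>)"
        using \<tau> fv_\<phi> fv_\<psi> by (auto simp: fv_foldr)
      then show ?thesis
        using sat_foldr_Ex [of ys \<psi> "\<sigma> ++ \<tau>" \<Pi> B] by simp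
    qed
    then show ?thesis
      using closed unfolding goal_form_def by (subst sat_foldr_All) auto
  qed
  show ?thesis
  proof (intro iffI allI impI)
    fix B H \<tau>
    assume achieves: "achieves \<Pi> (goal_form xs \<phi> ys \<psi>)" and shape: "shape \<Pi> A B H"
      and \<tau>: "assignment \<Pi> \<tau> \<and> extends_on xs \<tau> (hom_asg A H \<sigma>')"
    have H: "hom A B H" and B: "realized \<Pi> B" "skeleton \<Pi> B"
      using shape by (simp_all add: shape_def realized_def)
    have dom: "dom \<tau> = set xs"
      using \<tau> by (simp add: extends_on_def)
    \<comment> \<open>The goal is closed, so the empty assignment is admissible, and \<tau> alone
      then fixes the values of \<open>xs\<close>.\<close>
    have "sat \<Pi> B Map.empty (goal_form xs \<phi> ys \<psi>)"
      using achieves B(1) by (simp add: achieves_def satisfies_def assignment_def)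
    moreover have "sat \<Pi> B \<tau> \<phi>"
      using sat_claim_hom_asg [OF A B(2) H claim sat_A] \<tau> by (simp add: extends_on_def)
    ultimately obtain \<tau>' where \<tau>': "dom \<tau>' = set ys" "assignment \<Pi> \<tau>'" "sat \<Pi> B (\<tau> ++ \<tau>') \<psi>"
      unfolding sat_goal empty_map_add using dom \<tau> by blast
    have "assignment \<Pi> (\<tau> ++ \<tau>')"
      using \<tau> \<tau>'(2) by (auto simp: assignment_def ran_def map_add_Some_iff)
    moreover have "\<tau> \<subseteq>\<^sub>m \<tau> ++ \<tau>'"
      using dom \<tau>'(1) disjoint by (metis map_add_comm map_le_map_add)
    ultimately show "\<exists>\<sigma>. assignment \<Pi> \<sigma> \<and> \<tau> \<subseteq>\<^sub>m \<sigma> \<and> sat \<Pi> B \<sigma> \<psi>"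
      using \<tau>'(3) by blast
  next
    assume shapes: "\<forall>B H. shape \<Pi> A B H \<longrightarrow>
      (\<forall>\<tau>. assignment \<Pi> \<tau> \<and> extends_on xs \<tau> (hom_asg A H \<sigma>') \<longrightarrow>
        (\<exists>\<sigma>. assignment \<Pi> \<sigma> \<and> \<tau> \<subseteq>\<^sub>m \<sigma> \<and> sat \<Pi> B \<sigma> \<psi>))"
    have "\<exists>\<tau>'. dom \<tau>' = set ys \<and> assignment \<Pi> \<tau>' \<and> sat \<Pi> C (\<sigma> ++ \<tau> ++ \<tau>') \<psi>"
      if C: "realized \<Pi> C" and \<sigma>: "assignment \<Pi> \<sigma>" and \<tau>: "dom \<tau> = set xs" "assignment \<Pi> \<tau>"
        and sat_C: "sat \<Pi> C (\<sigma> ++ \<tau>) \<phi>" for C \<sigma> \<tau>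
    proof -
      have skel_C: "skeleton \<Pi> C"
        using C by (simp add: realized_def)
      have "assignment \<Pi> (\<sigma> ++ \<tau>)"
        using \<sigma> \<tau>(2) by (auto simp: assignment_def ran_def map_add_Some_iff)
      then obtain K where K: "hom A C K" "(\<sigma> ++ \<tau>) |` fv \<phi> = hom_asg A K \<sigma>'"
        using assms(4) skel_C sat_C unfolding characteristic_def by blast
      obtain r where r: "hom A (trim A) r" "hom_eq A r hom_ident"
        by (rule characteristic_retraction [OF claim assms(4)])
      obtain B H J where shape: "shape \<Pi> A B H" and J: "hom B C J" and KJH: "hom_eq A K (hom_comp J H)"
        by (rule shape_below [OF A r C K(1)])
      have H: "hom A B H" and B: "skeleton \<Pi> B"
        using shape by (simp_all add: shape_def realized_def)
      obtain N where fresh: "\<And>x. fresh_node N x \<notin> nodes B"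
        using ex_fresh_node [OF B] by blast
      \<comment> \<open>Subtracting \<open>N\<close> from the identity \<open>N + x\<close> recovers
        \<open>x\<close>, so the fresh node of \<open>x\<close> is sent to \<open>\<tau> x\<close>.
        On the remaining nodes outside \<open>B\<close> the choice only has to stay within
        \<open>vals \<Pi>\<close>.\<close>
      define h where "h v = (case v of MsgV t \<Rightarrow> MsgV (app (snd J) t)
        | NodeV n \<Rightarrow> if n \<in> nodes B then NodeV (fst J n)
            else case \<tau> (fst (fst n) - N) of Some w \<Rightarrow> w | None \<Rightarrow> NodeV n)" for v
      have h: "h (MsgV t) = MsgV (app (snd J) t)" "n \<in> nodes B \<Longrightarrow> h (NodeV n) = NodeV (fst J n)" for t n
        by (simp_all add: h_def)
      have h_vals: "h v \<in> vals \<Pi>" if "v \<in> vals \<Pi>" for v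
      proof (cases v)
        case (NodeV n)
        have "w \<in> vals \<Pi>" if "\<tau> y = Some w" for y w
          using \<tau>(2) that ranI unfolding assignment_def by fast
        moreover have "NodeV (fst J n) \<in> vals \<Pi>" if "n \<in> nodes B"
          using hom_node [OF J that] skeleton_nodes(2) [OF skel_C] unfolding vals_def by blast
        ultimately show ?thesis
          using NodeV that by (simp add: h_def split: option.split)
      qed (simp add: h vals_def)
      \<comment> \<open>A variable of \<open>xs\<close> outside \<open>\<phi>\<close> has no value to pull back along \<open>J\<close>.  In \<open>B\<close> it denotes a
        private node outside \<open>B\<close>, of which no atomic formula but an equation can be true.\<close>
      define \<tau>B where "\<tau>B x = (if x \<in> fv \<phi> then hom_asg A H \<sigma>' x
        else if x \<in> set xs then Some (NodeV (fresh_node N x)) else None)" for x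
      have dom_H: "dom (hom_asg A H \<sigma>') = fv \<phi>"
        by (rule characteristic_dom [OF assms(4)])
      then have H_Some: "(\<exists>v. hom_asg A H \<sigma>' x = Some v) \<longleftrightarrow> x \<in> fv \<phi>" for x
        unfolding dom_H [symmetric] by auto
      have "extends_on xs \<tau>B (hom_asg A H \<sigma>')"
        using H_Some fv_\<phi> by (auto simp: extends_on_def map_le_def \<tau>B_def split: if_splits)
      moreover have "assignment \<Pi> \<tau>B"
      proof -
        have "NodeV (fst H n) \<in> vals \<Pi>" if "n \<in> nodes A" for n
          using hom_node [OF H that] skeleton_nodes(2) [OF B] unfolding vals_def by blast
        moreover have "MsgV t \<in> vals \<Pi>" for t
          by (simp add: vals_def)
        ultimately have "v \<in> vals \<Pi>" if "hom_asg A H \<sigma>' x = Some v" for x v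
          using that by (cases "the (\<sigma>' x)") (auto simp: hom_asg_def bind_eq_Some_conv split: if_splits)
        moreover have "NodeV (fresh_node N x) \<in> vals \<Pi>" for x
          using fresh_node_nodes_of unfolding vals_def by blast
        ultimately show ?thesis
          by (auto simp: assignment_def ran_def \<tau>B_def split: if_splits)
      qed
      ultimately obtain \<sigma>B where \<sigma>B: "assignment \<Pi> \<sigma>B" "\<tau>B \<subseteq>\<^sub>m \<sigma>B" "sat \<Pi> B \<sigma>B \<psi>"
        using shapes shape by blast
      have \<tau>_xs: "\<tau> x = map_option h (\<sigma>B x)" if x: "x \<in> set xs" for x
      proof -
        have "\<tau> x = map_option h (\<tau>B x)"
        proof (cases "x \<in> fv \<phi>")
          case True
          have "\<tau> x = hom_asg A K \<sigma>' x"
            using fun_cong [OF K(2), of x] True x \<tau>(1)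
            by (auto simp: map_add_def split: option.splits)
          also have "\<dots> = hom_asg A (hom_comp J H) \<sigma>' x"
            using claim_hom_asg_eq [OF A sat_A claim True hom_mhom [OF K(1)] _ KJH]
              hom_mhom [OF H] hom_mhom [OF J] by (simp add: mhom_mhom_comp)
          also have "\<dots> = map_option h (\<tau>B x)"
            using hom_asg_comp [OF H h] True by (simp add: \<tau>B_def)
          finally show ?thesis .
        next
          case False
          then show ?thesis
            using fresh x \<tau>(1) by (auto simp: \<tau>B_def h_def fresh_node_def split: option.split)
        qed
        moreover have "\<tau>B x = \<sigma>B x"
          using \<sigma>B(2) x H_Some [of x] by (auto simp: map_le_def dom_def \<tau>B_def)
        ultimately show ?thesis by simp
      qed
      \<comment> \<open>\<open>\<sigma>B\<close> may be undefined at a \<open>y\<close> that does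
        not occur in \<psi>, but the domain must be all of \<open>ys\<close>;
        \<open>MsgV (Ind 0)\<close> is an arbitrary legal value.\<close>
      define \<tau>' where "\<tau>' y = (if y \<in> set ys
        then Some (case \<sigma>B y of Some v \<Rightarrow> h v | None \<Rightarrow> MsgV (Ind 0)) else None)" for y
      have "dom \<tau>' = set ys"
        by (auto simp: \<tau>'_def split: if_splits)
      moreover have "assignment \<Pi> \<tau>'"
      proof -
        have "h v \<in> vals \<Pi>" if "\<sigma>B y = Some v" for y v
          using h_vals \<sigma>B(1) ranI [of \<sigma>B, OF that] unfolding assignment_def by blast
        moreover have "MsgV (Ind 0) \<in> vals \<Pi>"
          by (simp add: vals_def)
        ultimately show ?thesis
          by (auto simp: assignment_def ran_def \<tau>'_def split: if_splits option.split)
      qed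
      moreover have "sat \<Pi> C (\<sigma> ++ \<tau> ++ \<tau>') \<psi>"
      proof (rule sat_Disj_hom [OF B skel_C J h \<psi> _ \<sigma>B(3)])
        fix x
        assume x: "x \<in> fv \<psi>"
        then obtain v where v: "\<sigma>B x = Some v"
          using sat_fv_dom [OF \<sigma>B(3)] by auto
        show "(\<sigma> ++ \<tau> ++ \<tau>') x = map_option h (\<sigma>B x)"
        proof (cases "x \<in> set ys")
          case False
          then have "x \<in> set xs"
            using x fv_\<psi> by auto
          then show ?thesis
            using \<tau>_xs v False by (simp add: \<tau>'_def map_add_def)
        qed (simp add: \<tau>'_def map_add_def v)
      qed
      ultimately show ?thesis by blast
    qed
    then show "achieves \<Pi> (goal_form xs \<phi> ys \<psi>)"
      unfolding achieves_def satisfies_def sat_goal by blast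
  qed
qed

end
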